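(* Let $T$ be an algebraic torus over an algebraically closed field $k$, with character lattice $\Lambda$, acting linearly on $V=k^n$ by $t(x_1,\ldots,x_n)=(\chi_1(t)x_1,\ldots,\chi_n(t)x_n)$ with $\chi_1,\ldots,\chi_n\in\Lambda$. Let $K$ be the cone in $\Lambda\otimes_{\mathbb{Z}}\mathbb{Q}$ generated by $\chi_1,\ldots,\chi_n$. Then the orbit closure $X=\overline{T(1,\ldots,1)}\subset V$ satisfies the separation property (SP) if and only if the following conditions hold: (1) the cone $K$ is strictly convex; (2) $\mathbb{Q}_+\chi_i$ is an edge of $K$ for every $i$; (3) $\mathbb{Q}_+\chi_i\neq\mathbb{Q}_+\chi_j$ for $i\neq j$.
   Context: A subset $X$ of a vector space $V$ has the separation property (SP) if for any pair of linearly independent linear functions $\alpha,\beta\in V^*$ there exists a point $x\in X$ such that $\alpha(x)=0$ and $\beta(x)\neq 0$. Closures are Zariski closures. $\mathbb{Q}_+$ is the set of non-negative rationals; the cone generated by $\chi_1,\dots,\chi_n$ is $\{\sum q_i\chi_i: q_i\in\mathbb{Q}_+\}$ (with characters viewed in $\Lambda\otimes_{\mathbb Z}\mathbb{Q}$). A cone is strictly convex if it contains no line. An edge of $K$ is a one-dimensional face of $K$; in the degenerate case $n=1$, $\chi_1=0$ (where $K=\{0\}$) the set $\mathbb{Q}_+\chi_1=K$ is counted as an edge. *)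

theory Defs
  imports "HOL-Analysis.Analysis" "HOL-Algebra.Product_Groups"
begin

section \<open>Algebraic tori and their character groups\<close>

definition Gm :: "'k::field monoid" where
  "Gm = \<lparr>carrier = {x. x \<noteq> 0}, mult = (*), one = 1\<rparr>"

abbreviation Gm_power :: "nat \<Rightarrow> (nat \<Rightarrow> 'k::field) monoid" where
  "Gm_power r \<equiv> product_group {..<r} (\<lambda>_. Gm)"

text \<open>The coordinate ring of the \<open>r\<close>-fold power of the multiplicative group: Laurent
  polynomials in \<open>r\<close> variables. Only the values on the carrier of the group matter.\<close>

definition laurent_functions :: "nat \<Rightarrow> ((nat \<Rightarrow> 'k::field) \<Rightarrow> 'k) set" where
  "laurent_functions r =
     {f. \<exists>(A :: (nat \<Rightarrow> int) set) c. finite A \<and>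
           (\<forall>t\<in>carrier (Gm_power r). f t = (\<Sum>a\<in>A. c a * (\<Prod>i<r. t i powi a i)))}"

text \<open>A group \<open>T\<close> whose ring of regular functions is \<open>R\<close> is an algebraic torus if it is
  isomorphic, as an algebraic group, to some power of the multiplicative group.\<close>

definition algebraic_torus :: "('t, 'm) monoid_scheme \<Rightarrow> ('t \<Rightarrow> 'k::field) set \<Rightarrow> bool" where
  "algebraic_torus T R \<longleftrightarrow> group T \<and>
     (\<exists>r. \<exists>\<phi>\<in>iso T (Gm_power r).
        R = {f. \<exists>g\<in>laurent_functions r. \<forall>t\<in>carrier T. f t = g (\<phi> t)})"

text \<open>Characters are the morphisms of algebraic groups from \<open>T\<close> to \<open>Gm\<close>. The inverse of a
  character is its composition with the inversion of \<open>T\<close>, hence automatically regular.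
  Restricting to extensional functions makes equality of characters mean equality on \<open>T\<close>.\<close>

definition character_group ::
  "('t, 'm) monoid_scheme \<Rightarrow> ('t \<Rightarrow> 'k::field) set \<Rightarrow> ('t \<Rightarrow> 'k) monoid" where
  "character_group T R =
     \<lparr>carrier = hom T Gm \<inter> R \<inter> extensional (carrier T),
      mult = (\<lambda>\<theta> \<psi>. \<lambda>t\<in>carrier T. \<theta> t * \<psi> t),
      one = (\<lambda>t\<in>carrier T. 1)\<rparr>"

section \<open>Extension of scalars to the rationals\<close>

text \<open>The rational vector space \<open>W\<close> (with scalar multiplication \<open>s\<close>), together with the map
  \<open>\<iota>\<close> playing the role of \<open>\<theta> \<mapsto> \<theta> \<otimes> 1\<close>, is the tensor product of the abelian group
  \<open>\<Lambda>\<close> with the rationals, presented as the localization of \<open>\<Lambda>\<close> at the nonzero integers: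
  the kernel of \<open>\<iota>\<close> is the torsion of \<open>\<Lambda>\<close> and every vector has the form \<open>\<iota> \<theta> / d\<close>.
  The universal property of the tensor product is derived below.\<close>

definition rationalization ::
  "('l, 'm) monoid_scheme \<Rightarrow> (rat \<Rightarrow> 'w::ab_group_add \<Rightarrow> 'w) \<Rightarrow> ('l \<Rightarrow> 'w) \<Rightarrow> bool" where
  "rationalization \<Lambda> s \<iota> \<longleftrightarrow> vector_space s \<and>
     (\<forall>\<theta>\<in>carrier \<Lambda>. \<forall>\<psi>\<in>carrier \<Lambda>. \<iota> (\<theta> \<otimes>\<^bsub>\<Lambda>\<^esub> \<psi>) = \<iota> \<theta> + \<iota> \<psi>) \<and>
     (\<forall>\<theta>\<in>carrier \<Lambda>. \<iota> \<theta> = 0 \<longrightarrow> (\<exists>d::nat. d > 0 \<and> \<theta> [^]\<^bsub>\<Lambda>\<^esub> d = \<one>\<^bsub>\<Lambda>\<^esub>)) \<and>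
     (\<forall>w. \<exists>\<theta>\<in>carrier \<Lambda>. \<exists>d::nat. d > 0 \<and> s (of_nat d) w = \<iota> \<theta>)"

lemma additive_on_group:
  fixes h :: "'l \<Rightarrow> 'w::ab_group_add"
  assumes "vector_space (s :: rat \<Rightarrow> 'w \<Rightarrow> 'w)" "group \<Lambda>"
    and add: "\<forall>\<theta>\<in>carrier \<Lambda>. \<forall>\<psi>\<in>carrier \<Lambda>. h (\<theta> \<otimes>\<^bsub>\<Lambda>\<^esub> \<psi>) = h \<theta> + h \<psi>"
  shows "h \<one>\<^bsub>\<Lambda>\<^esub> = 0"
    and "\<theta> \<in> carrier \<Lambda> \<Longrightarrow> h (inv\<^bsub>\<Lambda>\<^esub> \<theta>) = - h \<theta>"
    and "\<theta> \<in> carrier \<Lambda> \<Longrightarrow> h (\<theta> [^]\<^bsub>\<Lambda>\<^esub> (d::nat)) = s (of_nat d) (h \<theta>)"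
proof -
  interpret V: vector_space s by fact
  interpret group \<Lambda> by fact
  show one: "h \<one>\<^bsub>\<Lambda>\<^esub> = 0"
    using add[rule_format, of "\<one>\<^bsub>\<Lambda>\<^esub>" "\<one>\<^bsub>\<Lambda>\<^esub>"] by simp
  show "h (inv\<^bsub>\<Lambda>\<^esub> \<theta>) = - h \<theta>" if "\<theta> \<in> carrier \<Lambda>"
    using add[rule_format, of "inv\<^bsub>\<Lambda>\<^esub> \<theta>" \<theta>] that one by (simp add: eq_neg_iff_add_eq_0)
  show "h (\<theta> [^]\<^bsub>\<Lambda>\<^esub> (d::nat)) = s (of_nat d) (h \<theta>)" if "\<theta> \<in> carrier \<Lambda>"
    using that by (induction d) (simp_all add: one add V.scale_left_distrib add.commute)
qed

lemma rationalization_universal: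
  fixes s :: "rat \<Rightarrow> 'w::ab_group_add \<Rightarrow> 'w" and s' :: "rat \<Rightarrow> 'u::ab_group_add \<Rightarrow> 'u"
  assumes \<Lambda>: "comm_group \<Lambda>" and rat: "rationalization \<Lambda> s \<iota>" and V': "vector_space s'"
    and add: "\<forall>\<theta>\<in>carrier \<Lambda>. \<forall>\<psi>\<in>carrier \<Lambda>. f (\<theta> \<otimes>\<^bsub>\<Lambda>\<^esub> \<psi>) = f \<theta> + f \<psi>"
  shows "\<exists>!g. Vector_Spaces.linear s s' g \<and> (\<forall>\<theta>\<in>carrier \<Lambda>. g (\<iota> \<theta>) = f \<theta>)"
proof -
  interpret \<Lambda>: comm_group \<Lambda> by fact
  have V: "vector_space s" using rat by (simp add: rationalization_def)
  interpret V: vector_space s by fact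
  interpret V': vector_space s' by fact
  have \<iota>_add: "\<forall>\<theta>\<in>carrier \<Lambda>. \<forall>\<psi>\<in>carrier \<Lambda>. \<iota> (\<theta> \<otimes>\<^bsub>\<Lambda>\<^esub> \<psi>) = \<iota> \<theta> + \<iota> \<psi>"
    using rat by (simp add: rationalization_def)
  note \<iota>s = additive_on_group[where h=\<iota>, OF V \<Lambda>.is_group \<iota>_add]
  note fs = additive_on_group[where h=f, OF V' \<Lambda>.is_group add]
  have f_eq: "f \<theta> = f \<psi>" if "\<theta> \<in> carrier \<Lambda>" "\<psi> \<in> carrier \<Lambda>" "\<iota> \<theta> = \<iota> \<psi>" for \<theta> \<psi>
  proof -
    have mem: "\<theta> \<otimes>\<^bsub>\<Lambda>\<^esub> inv\<^bsub>\<Lambda>\<^esub> \<psi> \<in> carrier \<Lambda>"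
      using that by simp
    have "\<iota> (\<theta> \<otimes>\<^bsub>\<Lambda>\<^esub> inv\<^bsub>\<Lambda>\<^esub> \<psi>) = 0"
      using that by (simp add: \<iota>_add \<iota>s(2))
    then obtain d :: nat where d: "d > 0" "(\<theta> \<otimes>\<^bsub>\<Lambda>\<^esub> inv\<^bsub>\<Lambda>\<^esub> \<psi>) [^]\<^bsub>\<Lambda>\<^esub> d = \<one>\<^bsub>\<Lambda>\<^esub>"
      using rat mem unfolding rationalization_def by blast
    have "s' (of_nat d) (f (\<theta> \<otimes>\<^bsub>\<Lambda>\<^esub> inv\<^bsub>\<Lambda>\<^esub> \<psi>)) = 0"
      using fs(3)[OF mem, of d] d(2) fs(1) by simp
    then show ?thesis
      using d that by (simp add: add fs(2))
  qed
  have "\<exists>u. \<forall>\<theta>\<in>carrier \<Lambda>. \<forall>d::nat. d > 0 \<longrightarrow> s (of_nat d) w = \<iota> \<theta> \<longrightarrow> s' (of_nat d) u = f \<theta>" for w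
  proof -
    obtain \<theta> and d :: nat where \<theta>: "\<theta> \<in> carrier \<Lambda>" "d > 0" "s (of_nat d) w = \<iota> \<theta>"
      using rat unfolding rationalization_def by blast
    have "s' (of_nat e) (s' (1 / of_nat d) (f \<theta>)) = f \<psi>"
      if \<psi>: "\<psi> \<in> carrier \<Lambda>" "e > 0" "s (of_nat e) w = \<iota> \<psi>" for \<psi> and e :: nat
    proof -
      have "\<iota> (\<theta> [^]\<^bsub>\<Lambda>\<^esub> e) = \<iota> (\<psi> [^]\<^bsub>\<Lambda>\<^esub> d)"
        unfolding \<iota>s(3)[OF \<theta>(1)] \<iota>s(3)[OF \<psi>(1)] \<theta>(3)[symmetric] \<psi>(3)[symmetric]
        by (simp add: mult.commute)
      then have eq: "s' (of_nat e) (f \<theta>) = s' (of_nat d) (f \<psi>)"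
        using f_eq[of "\<theta> [^]\<^bsub>\<Lambda>\<^esub> e" "\<psi> [^]\<^bsub>\<Lambda>\<^esub> d"] \<theta> \<psi> by (simp add: fs(3))
      have "s' (of_nat e) (s' (1 / of_nat d) (f \<theta>)) = s' (1 / of_nat d) (s' (of_nat e) (f \<theta>))"
        by (simp add: mult.commute)
      also have "\<dots> = f \<psi>" unfolding eq using \<theta> by simp
      finally show ?thesis .
    qed
    then show ?thesis by blast
  qed
  then obtain g where g: "\<And>w \<theta> (d::nat). \<theta> \<in> carrier \<Lambda> \<Longrightarrow> d > 0 \<Longrightarrow> s (of_nat d) w = \<iota> \<theta> \<Longrightarrow>
      s' (of_nat d) (g w) = f \<theta>"
    by metis
  have g\<iota>: "g (\<iota> \<theta>) = f \<theta>" if "\<theta> \<in> carrier \<Lambda>" for \<theta>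
    using g[of \<theta> 1 "\<iota> \<theta>"] that by simp
  have g_add: "g (v + w) = g v + g w" for v w
  proof -
    obtain \<theta> and d :: nat where \<theta>: "\<theta> \<in> carrier \<Lambda>" "d > 0" "s (of_nat d) v = \<iota> \<theta>"
      using rat unfolding rationalization_def by blast
    obtain \<psi> and e :: nat where \<psi>: "\<psi> \<in> carrier \<Lambda>" "e > 0" "s (of_nat e) w = \<iota> \<psi>"
      using rat unfolding rationalization_def by blast
    have v: "s' (of_nat d) (g v) = f \<theta>" and w: "s' (of_nat e) (g w) = f \<psi>"
      using g \<theta> \<psi> by blast+
    have "s (of_nat (d * e)) (v + w) = s (of_nat e) (s (of_nat d) v) + s (of_nat d) (s (of_nat e) w)"
      by (simp add: V.scale_right_distrib mult.commute)
    also have "\<dots> = \<iota> (\<theta> [^]\<^bsub>\<Lambda>\<^esub> e \<otimes>\<^bsub>\<Lambda>\<^esub> \<psi> [^]\<^bsub>\<Lambda>\<^esub> d)"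
      using \<theta> \<psi> by (simp add: \<iota>_add \<iota>s(3) del: V.scale_scale)
    finally have "s' (of_nat (d * e)) (g (v + w)) = f (\<theta> [^]\<^bsub>\<Lambda>\<^esub> e \<otimes>\<^bsub>\<Lambda>\<^esub> \<psi> [^]\<^bsub>\<Lambda>\<^esub> d)"
      using g[of "\<theta> [^]\<^bsub>\<Lambda>\<^esub> e \<otimes>\<^bsub>\<Lambda>\<^esub> \<psi> [^]\<^bsub>\<Lambda>\<^esub> d" "d * e" "v + w"] \<theta> \<psi> by simp
    also have "\<dots> = s' (of_nat e) (f \<theta>) + s' (of_nat d) (f \<psi>)"
      using \<theta> \<psi> by (simp add: add fs(3))
    also have "\<dots> = s' (of_nat (d * e)) (g v + g w)"
      unfolding v[symmetric] w[symmetric] by (simp add: V'.scale_right_distrib mult.commute)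
    finally show ?thesis using \<theta> \<psi> by (simp del: of_nat_mult)
  qed
  interpret g: additive g by standard (rule g_add)
  have g_nat: "g (s (of_nat m) v) = s' (of_nat m) (g v)" for m v
    by (induction m) (simp_all add: g.zero g_add V.scale_left_distrib V'.scale_left_distrib)
  have g_int: "g (s (of_int z) v) = s' (of_int z) (g v)" for z v
    using g_nat[of _ v] g.minus by (cases z rule: int_cases2) auto
  have g_scale: "g (s q v) = s' q (g v)" for q v
  proof -
    obtain a b where q: "q = of_int a / of_int b" "b > 0"
      by (metis quotient_of_denom_pos quotient_of_div surj_pair)
    have "s' (of_int b) (g (s q v)) = g (s (of_int b) (s q v))" by (simp only: g_int)
    also have "\<dots> = g (s (of_int a) v)" using q by simp
    also have "\<dots> = s' (of_int b) (s' q (g v))" using q by (simp add: g_int)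
    finally show ?thesis
      by (rule V'.scale_left_imp_eq[rotated]) (use q in simp)
  qed
  show ?thesis
  proof (rule ex1I[of _ g])
    have "Vector_Spaces.linear s s' g"
      using g_add g_scale V V'
      by (simp add: Vector_Spaces.linear_def module_hom_def module_hom_axioms_def V.module_axioms V'.module_axioms)
    then show "Vector_Spaces.linear s s' g \<and> (\<forall>\<theta>\<in>carrier \<Lambda>. g (\<iota> \<theta>) = f \<theta>)"
      using g\<iota> by blast
  next
    fix h assume h: "Vector_Spaces.linear s s' h \<and> (\<forall>\<theta>\<in>carrier \<Lambda>. h (\<iota> \<theta>) = f \<theta>)"
    interpret h: Vector_Spaces.linear s s' h using h by blast
    show "h = g"
    proof
      fix w
      obtain \<theta> and d :: nat where \<theta>: "\<theta> \<in> carrier \<Lambda>" "d > 0" "s (of_nat d) w = \<iota> \<theta>"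
        using rat unfolding rationalization_def by blast
      have "s' (of_nat d) (h w) = s' (of_nat d) (g w)"
        unfolding g[OF \<theta>] h.scale[symmetric] \<theta>(3) using h \<theta>(1) by blast
      then show "h w = g w" using \<theta> by simp
    qed
  qed
qed

section \<open>Cones in rational vector spaces\<close>

definition cone_generated ::
  "(rat \<Rightarrow> 'w::ab_group_add \<Rightarrow> 'w) \<Rightarrow> ('n::finite \<Rightarrow> 'w) \<Rightarrow> 'w set" where
  "cone_generated s v = {\<Sum>i\<in>UNIV. s (q i) (v i) | q. \<forall>i. 0 \<le> q i}"

definition ray :: "(rat \<Rightarrow> 'w::ab_group_add \<Rightarrow> 'w) \<Rightarrow> 'w \<Rightarrow> 'w set" where
  "ray s v = {s q v | q. 0 \<le> q}"

definition strictly_convex :: "(rat \<Rightarrow> 'w::ab_group_add \<Rightarrow> 'w) \<Rightarrow> 'w set \<Rightarrow> bool" where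
  "strictly_convex s K \<longleftrightarrow> \<not> (\<exists>w d. d \<noteq> 0 \<and> range (\<lambda>q. w + s q d) \<subseteq> K)"

text \<open>Faces are the intersections of the cone with its supporting hyperplanes (and the cone
  itself, for the zero functional).\<close>

definition is_face :: "(rat \<Rightarrow> 'w::ab_group_add \<Rightarrow> 'w) \<Rightarrow> 'w set \<Rightarrow> 'w set \<Rightarrow> bool" where
  "is_face s K F \<longleftrightarrow>
     (\<exists>l. Vector_Spaces.linear s (*) l \<and> (\<forall>x\<in>K. 0 \<le> l x) \<and> F = {x\<in>K. l x = 0})"

definition is_edge :: "(rat \<Rightarrow> 'w::ab_group_add \<Rightarrow> 'w) \<Rightarrow> 'w set \<Rightarrow> 'w set \<Rightarrow> bool" where
  "is_edge s K F \<longleftrightarrow> is_face s K F \<and> vector_space.dim s F = 1"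

section \<open>Zariski closure, diagonal actions, and the separation property\<close>

definition polynomial_functions :: "(('k::field)^'n::finite \<Rightarrow> 'k) set" where
  "polynomial_functions =
     {f. \<exists>(A :: ('n \<Rightarrow> nat) set) c. finite A \<and>
           (\<forall>x. f x = (\<Sum>a\<in>A. c a * (\<Prod>i\<in>UNIV. (x $ i) ^ a i)))}"

definition zariski_closed :: "(('k::field)^'n::finite) set \<Rightarrow> bool" where
  "zariski_closed Z \<longleftrightarrow> (\<exists>F\<subseteq>polynomial_functions. Z = {x. \<forall>f\<in>F. f x = 0})"

definition diagonal_action ::
  "('n::finite \<Rightarrow> 't \<Rightarrow> 'k::field) \<Rightarrow> 't \<Rightarrow> 'k^'n \<Rightarrow> 'k^'n" where
  "diagonal_action c t x = (\<chi> i. c i t * x $ i)"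

definition separation_property ::
  "('k::field \<Rightarrow> 'v::ab_group_add \<Rightarrow> 'v) \<Rightarrow> 'v set \<Rightarrow> bool" where
  "separation_property s X \<longleftrightarrow>
     (\<forall>\<alpha> \<beta>. Vector_Spaces.linear s (*) \<alpha> \<longrightarrow> Vector_Spaces.linear s (*) \<beta> \<longrightarrow>
        (\<forall>a b. (\<forall>x. a * \<alpha> x + b * \<beta> x = 0) \<longrightarrow> a = 0 \<and> b = 0) \<longrightarrow>
        (\<exists>x\<in>X. \<alpha> x = 0 \<and> \<beta> x \<noteq> 0))"

end

theory Submission
  imports Defs "HOL-Computational_Algebra.Polynomial"
begin

text \<open>The combinatorial conditions say that every \<open>\<chi>\<^sub>i\<close> is exposed: some functional vanishes on
  \<open>\<chi>\<^sub>i\<close> and is positive on all other \<open>\<chi>\<^sub>p\<close>. If \<open>n \<ge> 2\<close> and some \<open>\<chi>\<^sub>i\<close> is not exposed, the Farkas lemma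
  yields a relation between the characters, hence a binomial equation on \<open>X\<close> that contradicts the
  existence of points with \<open>x\<^sub>j = 0\<close> and \<open>x\<^sub>i \<noteq> 0\<close>.

  Conversely, let all \<open>\<chi>\<^sub>i\<close> be exposed, and let \<open>\<alpha>\<close>, \<open>\<beta>\<close> be independent. All coordinate vectors lie in
  \<open>X\<close>, which settles the case that the support of \<open>\<beta>\<close> is not contained in that of \<open>\<alpha>\<close>.
  Otherwise subtract a multiple of \<open>\<alpha>\<close> from \<open>\<beta>\<close> so that its support becomes strictly smaller
  than that of \<open>\<alpha>\<close>.
  Then some cocharacter attains its minimum at least twice on the support of \<open>\<alpha>\<close> but only
  once on that of \<open>\<beta>\<close>, so the leading term of \<open>\<alpha>\<close> along it has a zero in the torus and that
  of \<open>\<beta>\<close> has none. Such a zero lifts to a zero of \<open>\<alpha>\<close> at which \<open>\<beta>\<close> does not vanish.\<close>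

section \<open>Polynomials in two variables\<close>

text \<open>Over a finite field the product of all X - x, plus 1, would have positive degree but no
  root.\<close>

lemma infinite_UNIV_alg_closed: "infinite (UNIV :: 'k::alg_closed_field set)"
proof
  assume fin: "finite (UNIV :: 'k set)"
  define p :: "'k poly" where "p = (\<Prod>x\<in>UNIV. [:-x, 1:]) + 1"
  have "degree (\<Prod>x\<in>UNIV. [:-x, 1:] :: 'k poly) = card (UNIV :: 'k set)"
    by (subst degree_prod_eq_sum_degree) auto
  then have deg: "degree p = card (UNIV :: 'k set)"
    unfolding p_def using fin by (subst degree_add_eq_left) (auto simp: card_gt_0_iff)
  then have "degree p > 0"
    using fin by (simp add: card_gt_0_iff)
  then obtain a where "poly p a = 0"
    using alg_closed_imp_poly_has_root by blast
  moreover have "(\<Prod>x\<in>UNIV. a - x) = 0"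
    using fin by (intro prod_zero) auto
  ultimately show False
    unfolding p_def by (simp add: poly_prod)
qed

lemma poly_eq_if_cofinitely_eq:
  fixes p q :: "'k::alg_closed_field poly"
  assumes "finite A" and "\<And>x. x \<notin> A \<Longrightarrow> poly p x = poly q x"
  shows "p = q"
proof (rule ccontr)
  assume "p \<noteq> q"
  then have "finite {x. poly (p - q) x = 0}"
    by (intro poly_roots_finite) simp
  moreover have "UNIV \<subseteq> A \<union> {x. poly (p - q) x = 0}"
    using assms(2) by auto
  ultimately have "finite (UNIV :: 'k set)"
    using assms(1) by (meson finite_Un finite_subset)
  then show False
    using infinite_UNIV_alg_closed by blast
qed

lemma poly_nonroot_ex:
  fixes p :: "'k::alg_closed_field poly"
  assumes "p \<noteq> 0" "finite A"
  obtains x where "x \<notin> A" "poly p x \<noteq> 0"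
  using poly_eq_if_cofinitely_eq[of A p 0] assms by auto

text \<open>A Nullstellensatz in one variable: \<open>p\<close> splits into \<open>degree p\<close>
  linear factors, and each of them divides \<open>q\<close>.\<close>

lemma dvd_power_degree_if_roots_subset:
  fixes p q :: "'k::alg_closed_field poly"
  assumes "p \<noteq> 0" "\<And>x. poly p x = 0 \<Longrightarrow> poly q x = 0"
  shows "p dvd q ^ degree p"
  using assms
proof (induction "degree p" arbitrary: p)
  case 0
  then show ?case
    by (simp add: is_unit_iff_degree)
next
  case (Suc d)
  obtain x where x: "poly p x = 0"
    using alg_closed_imp_poly_has_root[of p] Suc.hyps(2) by auto
  then obtain r where r: "p = [:-x, 1:] * r"
    by (auto simp: poly_eq_0_iff_dvd)
  then have "r \<noteq> 0" "degree p = Suc (degree r)"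
    using Suc.prems(1) by (auto simp del: mult_pCons_left simp add: degree_mult_eq)
  then have "r dvd q ^ degree r"
    using Suc r by (intro Suc.hyps(1)) auto
  moreover have "[:-x, 1:] dvd q"
    using Suc.prems(2)[OF x] by (simp add: poly_eq_0_iff_dvd)
  ultimately show ?case
    unfolding \<open>degree p = Suc (degree r)\<close> power_Suc by (subst r) (rule mult_dvd_mono)
qed

text \<open>An element of \<open>'k poly poly\<close> is read as F(y, z), with y the outer variable
  and z the variable of the coefficients; z is the one that gets a value.\<close>

definition specialize :: "'k::comm_semiring_0 \<Rightarrow> 'k poly poly \<Rightarrow> 'k poly" where
  "specialize z = map_poly (\<lambda>c. poly c z)"

lemma coeff_specialize [simp]: "coeff (specialize z F) n = poly (coeff F n) z"
  by (simp add: specialize_def coeff_map_poly)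

lemma specialize_add [simp]: "specialize z (F + G) = specialize z F + specialize z G"
  by (simp add: poly_eq_iff)

lemma specialize_mult [simp]:
  "specialize z (F * G) = specialize z F * specialize z (G :: 'k::comm_ring_1 poly poly)"
  by (simp add: poly_eq_iff coeff_mult poly_sum)

lemma specialize_smult [simp]:
  "specialize z (smult c F) = smult (poly c z) (specialize z (F :: 'k::comm_ring_1 poly poly))"
  by (simp add: poly_eq_iff)

lemma specialize_1 [simp]: "specialize z 1 = (1 :: 'k::comm_ring_1 poly)"
  by (simp add: specialize_def)

lemma specialize_power [simp]:
  "specialize z (F ^ n) = specialize z (F :: 'k::comm_ring_1 poly poly) ^ n"
  by (induction n) simp_all

lemma degree_specialize_le: "degree (specialize z F) \<le> degree F"
  by (intro degree_le) (simp add: coeff_eq_0)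

text \<open>The parameter z is prime and does not divide \<open>F\<close>, so it divides
  \<open>Q\<close>: at z = 0 the product vanishes in the domain k[y]. Each induction step cancels
  one factor z.\<close>

lemma cancel_power_of_parameter:
  fixes F Q H :: "'k::field poly poly"
  assumes "specialize 0 F \<noteq> 0" "smult ([:0, 1:] ^ n * u) H = F * Q"
  shows "\<exists>Q'. smult u H = F * Q'"
  using assms(2)
proof (induction n arbitrary: Q)
  case (Suc n)
  have "specialize 0 (F * Q) = 0"
    unfolding Suc.prems[symmetric] by (simp add: poly_eq_iff)
  then have "specialize 0 Q = 0"
    using assms(1) by simp
  then have "[:0, 1:] dvd coeff Q i" for i
    using poly_eq_0_iff_dvd[of "coeff Q i" 0] by (metis coeff_specialize coeff_0 minus_zero)
  then have "[:[:0, 1:]:] dvd Q"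
    by (simp add: const_poly_dvd_iff)
  then obtain Q' where "Q = smult [:0, 1:] Q'"
    by (auto elim!: dvdE)
  then have "smult [:0, 1:] (smult ([:0, 1:] ^ n * u) H) = smult [:0, 1:] (F * Q')"
    using Suc.prems by (simp add: mult.assoc del: mult_pCons_left)
  then have "smult ([:0, 1:] ^ n * u) H = F * Q'"
    by (rule smult_cancel[rotated]) simp
  then show ?case
    by (rule Suc.IH)
qed auto

text \<open>If every zero of \<open>F\<close> with nonzero coordinates were a zero of \<open>G\<close>, then \<open>F(y, z)\<close> would divide
  \<open>(y G(y, z))\<^sup>d\<close> in \<open>k[y]\<close> for almost all \<open>z\<close>, hence generically, up to a denominator \<open>u(z)\<close>
  with \<open>u(0) \<noteq> 0\<close>.\<close>

lemma zero_near_specialization: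
  fixes F G :: "'k::alg_closed_field poly poly"
  assumes F0: "specialize 0 F \<noteq> 0" and y0: "poly (specialize 0 F) y0 = 0" "y0 \<noteq> 0"
    and G0: "poly (specialize 0 G) y0 \<noteq> 0"
  shows "\<exists>y z. y \<noteq> 0 \<and> z \<noteq> 0 \<and> poly (specialize z F) y = 0 \<and> poly (specialize z G) y \<noteq> 0"
proof (rule ccontr)
  assume "\<not> ?thesis"
  then have sub: "poly (specialize z G) y = 0" if "y \<noteq> 0" "z \<noteq> 0" "poly (specialize z F) y = 0" for y z
    using that by blast
  define d where "d = degree F"
  \<comment> \<open>Here \<open>[:0, 1:]\<close> is y. This factor takes care of the zeros of
    \<open>F\<close> with y = 0, where nothing is known about \<open>G\<close>.\<close>
  define H where "H = ([:0, 1:] * G) ^ d"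
  have "F \<noteq> 0"
    using F0 by (auto simp: specialize_def)
  \<comment> \<open>Division with respect to y, kept free of denominators in z by a power
    \<open>L\<close> of the leading coefficient.\<close>
  obtain Q R where QR: "pseudo_divmod H F = (Q, R)"
    by fastforce
  define L where "L = lead_coeff F ^ (Suc (degree H) - degree F)"
  have HQR: "smult L H = F * Q + R" and R: "R = 0 \<or> degree R < degree F"
    using pseudo_divmod[OF \<open>F \<noteq> 0\<close> QR] by (simp_all add: L_def)
  have lc: "lead_coeff F \<noteq> 0"
    using \<open>F \<noteq> 0\<close> by simp
  \<comment> \<open>Where the leading coefficient survives, \<open>F\<close> keeps its degree; it
    then divides \<open>H\<close>, hence also the remainder, whose degree is smaller.\<close>
  have spec_R: "specialize z R = 0" if z: "z \<noteq> 0" "poly (lead_coeff F) z \<noteq> 0" for z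
  proof -
    have deg: "degree (specialize z F) = d"
      unfolding d_def by (intro antisym degree_specialize_le le_degree) (use z(2) in auto)
    have "specialize z F \<noteq> 0"
      using z(2) by (metis coeff_specialize coeff_0)
    moreover have "poly (specialize z ([:0, 1:] * G)) y = 0" if "poly (specialize z F) y = 0" for y
      using sub[of y z] that z(1) by (cases "y = 0") (simp_all add: specialize_def map_poly_pCons)
    ultimately have "specialize z F dvd specialize z H"
      unfolding H_def specialize_power deg[symmetric] by (rule dvd_power_degree_if_roots_subset)
    moreover have "specialize z R = smult (poly L z) (specialize z H) - specialize z F * specialize z Q"
      using arg_cong[OF HQR, of "specialize z"] by simp
    ultimately have dvd: "specialize z F dvd specialize z R"
      by (simp add: dvd_smult)
    show ?thesis
    proof (rule ccontr)
      assume nz: "specialize z R \<noteq> 0"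
      then have "R \<noteq> 0"
        by (auto simp: specialize_def)
      then have "degree (specialize z R) < degree (specialize z F)"
        using R degree_specialize_le[of z R] unfolding deg d_def by linarith
      then show False
        using dvd_imp_degree_le[OF dvd nz] by simp
    qed
  qed
  have "finite ({0} \<union> {z. poly (lead_coeff F) z = 0})"
    using lc by (auto intro: poly_roots_finite)
  then have "coeff R i = 0" for i
    by (rule poly_eq_if_cofinitely_eq) (use spec_R in \<open>auto simp flip: coeff_specialize\<close>)
  then have "R = 0"
    by (simp add: poly_eq_iff)
  have "L \<noteq> 0"
    using lc by (simp add: L_def)
  \<comment> \<open>\<open>L\<close> may vanish at z = 0, so its powers of z are split off and
    cancelled before setting z = 0.\<close>
  then obtain u where u: "L = [:0, 1:] ^ Polynomial.order 0 L * u" "\<not> [:0, 1:] dvd u"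
    using order_decomp[of L 0] by auto
  then have u0: "poly u 0 \<noteq> 0"
    using poly_eq_0_iff_dvd[of u 0] by simp
  obtain Q' where "smult u H = F * Q'"
    using cancel_power_of_parameter[OF F0, of "Polynomial.order 0 L" u H Q] HQR \<open>R = 0\<close> u(1) by auto
  then have "smult (poly u 0) (specialize 0 H) = specialize 0 F * specialize 0 Q'"
    by (metis specialize_smult specialize_mult)
  then have "poly u 0 * poly (specialize 0 H) y0 = 0"
    using y0(1) by (metis poly_smult poly_mult mult_zero_left)
  then have "poly (specialize 0 ([:0, 1:] * G)) y0 = 0"
    using u0 by (simp add: H_def)
  then show False
    using y0(2) G0 by (simp add: specialize_def map_poly_pCons)
qed

section \<open>Alternatives for linear inequalities\<close>

lemma linear_functional_nonzero_ex:
  assumes "vector_space (s :: 'f::field \<Rightarrow> 'w::ab_group_add \<Rightarrow> 'w)" "w \<noteq> 0"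
  shows "\<exists>l. Vector_Spaces.linear s (*) l \<and> l w = 1"
proof -
  interpret vector_space_pair s "(*) :: 'f \<Rightarrow> 'f \<Rightarrow> 'f"
    unfolding vector_space_pair_def using assms(1) vector_space_over_itself.vector_space_axioms by blast
  show ?thesis
    using linear_independent_extend[of "{w}" "\<lambda>_. 1"] assms(2) by (auto simp: vs1.dependent_single)
qed

text \<open>The induction is Bartl's: eliminate \<open>v j\<close> with a functional \<open>l0\<close> violating the conclusion
  for the remaining vectors, normalized by \<open>l0 (v j) = -1\<close>.\<close>

lemma farkas:
  fixes s :: "'f::linordered_field \<Rightarrow> 'w::ab_group_add \<Rightarrow> 'w"
  assumes vs: "vector_space s" and "finite J"
    and "\<And>l. Vector_Spaces.linear s (*) l \<Longrightarrow> (\<And>p. p \<in> J \<Longrightarrow> 0 \<le> l (v p)) \<Longrightarrow> 0 \<le> l w"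
  shows "\<exists>q. (\<forall>p\<in>J. 0 \<le> q p) \<and> w = (\<Sum>p\<in>J. s (q p) (v p))"
  using assms(2,3)
proof (induction J arbitrary: v w rule: finite_induct)
  case empty
  have "w = 0"
  proof (rule ccontr)
    assume "w \<noteq> 0"
    then obtain l where l: "Vector_Spaces.linear s (*) l" "l w = 1"
      using linear_functional_nonzero_ex[OF vs] by blast
    then have "Vector_Spaces.linear s (*) (\<lambda>x. - l x)"
      by (simp add: Vector_Spaces.linear_iff)
    from empty[OF this] l(2) show False
      by simp
  qed
  then show ?case
    by simp
next
  case (insert j J)
  interpret vector_space s by fact
  show ?case
  proof (cases "\<forall>l. Vector_Spaces.linear s (*) l \<longrightarrow> (\<forall>p\<in>J. 0 \<le> l (v p)) \<longrightarrow> 0 \<le> l w")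
    case True
    then obtain q where q: "\<forall>p\<in>J. 0 \<le> q p" "w = (\<Sum>p\<in>J. s (q p) (v p))"
      using insert.IH[of v w] by blast
    have "(\<Sum>p\<in>J. s (q p) (v p)) = (\<Sum>p\<in>J. s ((q(j := 0)) p) (v p))"
      using insert.hyps by (intro sum.cong) auto
    then have "w = (\<Sum>p\<in>insert j J. s ((q(j := 0)) p) (v p))"
      using insert.hyps q(2) by simp
    then show ?thesis
      using q(1) by (intro exI[of _ "q(j := 0)"]) auto
  next
    case False
    then obtain l1 where l1: "Vector_Spaces.linear s (*) l1" "\<forall>p\<in>J. 0 \<le> l1 (v p)" "l1 w < 0"
      by (auto simp: not_le)
    have neg: "l1 (v j) < 0"
      using insert.prems[OF l1(1)] l1(2,3) by (force simp: not_le[symmetric])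
    define l0 where "l0 x = l1 x / (- l1 (v j))" for x
    have l0: "Vector_Spaces.linear s (*) l0" "\<And>p. p \<in> J \<Longrightarrow> 0 \<le> l0 (v p)" "l0 w < 0" "l0 (v j) = -1"
      using l1 neg by (simp_all add: Vector_Spaces.linear_iff l0_def add_divide_distrib
          divide_le_0_iff zero_less_divide_iff)
    \<comment> \<open>The projection along \<open>v j\<close> onto the kernel of \<open>l0\<close>.
      A functional composed with it kills \<open>v j\<close>, so the assumption on the full family
      applies to it.\<close>
    define \<pi> where "\<pi> x = x + s (l0 x) (v j)" for x
    have "0 \<le> l (\<pi> w)" if l: "Vector_Spaces.linear s (*) l" "\<And>p. p \<in> J \<Longrightarrow> 0 \<le> l (\<pi> (v p))" for l
    proof -
      define l' where "l' x = l x + l0 x * l (v j)" for x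
      have "Vector_Spaces.linear s (*) l'"
        using l(1) l0(1) by (simp add: Vector_Spaces.linear_iff l'_def algebra_simps)
      moreover have "l (\<pi> x) = l' x" for x
        using l(1) by (simp add: Vector_Spaces.linear_iff l'_def \<pi>_def)
      moreover have "l' (v j) = 0"
        using l0(4) by (simp add: l'_def)
      ultimately show ?thesis
        using insert.prems[of l'] l(2) by (metis insert_iff order.refl)
    qed
    then obtain q where q: "\<forall>p\<in>J. 0 \<le> q p" "\<pi> w = (\<Sum>p\<in>J. s (q p) (\<pi> (v p)))"
      using insert.IH[of "\<lambda>p. \<pi> (v p)" "\<pi> w"] by blast
    \<comment> \<open>The coefficient of \<open>v j\<close> collects what the projection has added;
      it is nonnegative because \<open>l0 w < 0\<close>.\<close>
    define q' where "q' = q(j := (\<Sum>p\<in>J. q p * l0 (v p)) - l0 w)"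
    have "\<pi> w = (\<Sum>p\<in>J. s (q p) (v p)) + s (\<Sum>p\<in>J. q p * l0 (v p)) (v j)"
      unfolding q(2) by (simp add: \<pi>_def scale_right_distrib sum.distrib scale_sum_left)
    then have "w = (\<Sum>p\<in>J. s (q p) (v p)) + s ((\<Sum>p\<in>J. q p * l0 (v p)) - l0 w) (v j)"
      by (simp add: \<pi>_def scale_left_diff_distrib algebra_simps)
    also have "(\<Sum>p\<in>J. s (q p) (v p)) = (\<Sum>p\<in>J. s (q' p) (v p))"
      using insert.hyps by (intro sum.cong) (auto simp: q'_def)
    finally have "w = (\<Sum>p\<in>insert j J. s (q' p) (v p))"
      using insert.hyps by (simp add: q'_def add.commute)
    moreover have "\<forall>p\<in>insert j J. 0 \<le> q' p"
    proof -
      have "0 \<le> (\<Sum>p\<in>J. q p * l0 (v p))"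
        using q(1) l0(2) by (simp add: sum_nonneg)
      then show ?thesis
        using q(1) l0(3) by (simp add: q'_def)
    qed
    ultimately show ?thesis
      by blast
  qed
qed

text \<open>If no functional that is nonnegative on the family is positive at \<open>v j\<close>,
  Farkas writes \<open>- v j\<close> as a nonnegative combination, which gives a relation with
  positive coefficient at \<open>v j\<close>. The functionals found for the various \<open>j\<close>
  are added up.\<close>

lemma gordan:
  fixes s :: "'f::linordered_field \<Rightarrow> 'w::ab_group_add \<Rightarrow> 'w"
  assumes vs: "vector_space s" and J: "finite J"
    and rel: "\<And>q. (\<forall>p\<in>J. 0 \<le> q p) \<Longrightarrow> (\<Sum>p\<in>J. s (q p) (v p)) = 0 \<Longrightarrow> \<forall>p\<in>J. q p = 0"
  shows "\<exists>l. Vector_Spaces.linear s (*) l \<and> (\<forall>p\<in>J. 0 < l (v p))"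
proof -
  interpret vector_space s by fact
  have "\<exists>l. Vector_Spaces.linear s (*) l \<and> (\<forall>p\<in>J. 0 \<le> l (v p)) \<and> 0 < l (v j)" if "j \<in> J" for j
  proof (rule ccontr)
    assume none: "\<not> ?thesis"
    have "0 \<le> l (- v j)" if l: "Vector_Spaces.linear s (*) l" "\<And>p. p \<in> J \<Longrightarrow> 0 \<le> l (v p)" for l
    proof -
      interpret l: Vector_Spaces.linear s "(*)" l by (rule l(1))
      show ?thesis
        using l none by (force simp: l.neg not_le[symmetric])
    qed
    then have "\<exists>q. (\<forall>p\<in>J. 0 \<le> q p) \<and> - v j = (\<Sum>p\<in>J. s (q p) (v p))"
      by (rule farkas[OF vs J])
    then obtain q where q: "\<forall>p\<in>J. 0 \<le> q p" "- v j = (\<Sum>p\<in>J. s (q p) (v p))"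
      by blast
    have "(\<Sum>p\<in>J. s ((q(j := q j + 1)) p) (v p)) = (\<Sum>p\<in>J. s (q p) (v p) + (if p = j then v p else 0))"
      by (intro sum.cong) (auto simp: scale_left_distrib)
    also have "\<dots> = 0"
      using J that by (simp add: sum.distrib q(2)[symmetric])
    finally have "\<forall>p\<in>J. (q(j := q j + 1)) p = 0"
      using q(1) by (intro rel) auto
    then show False
      using that q(1) by force
  qed
  then obtain l where l: "\<And>j. j \<in> J \<Longrightarrow>
      Vector_Spaces.linear s (*) (l j) \<and> (\<forall>p\<in>J. 0 \<le> l j (v p)) \<and> 0 < l j (v j)"
    by metis
  define L where "L x = (\<Sum>j\<in>J. l j x)" for x
  have "Vector_Spaces.linear s (*) L"
    using l vs vector_space_over_itself.vector_space_axioms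
    by (auto simp: Vector_Spaces.linear_iff L_def sum.distrib sum_distrib_left intro!: sum.cong)
  moreover have "0 < L (v p)" if "p \<in> J" for p
    unfolding L_def using J l that by (intro sum_pos2[of J p]) auto
  ultimately show ?thesis
    by blast
qed

text \<open>Gordan's alternative in the quotient by the line of \<open>u\<close>. The quotient is
  realized by projecting along \<open>u\<close> onto the kernel of some \<open>f\<close> with
  \<open>f u = 1\<close>.\<close>

lemma functional_positive_except_line:
  fixes s :: "'f::linordered_field \<Rightarrow> 'w::ab_group_add \<Rightarrow> 'w"
  assumes vs: "vector_space s" and J: "finite J" and "u \<noteq> 0"
    and rel: "\<And>q c. (\<forall>p\<in>J. 0 \<le> q p) \<Longrightarrow> (\<Sum>p\<in>J. s (q p) (v p)) = s c u \<Longrightarrow> \<forall>p\<in>J. q p = 0"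
  shows "\<exists>l. Vector_Spaces.linear s (*) l \<and> l u = 0 \<and> (\<forall>p\<in>J. 0 < l (v p))"
proof -
  interpret vector_space s by fact
  obtain f where f: "Vector_Spaces.linear s (*) f" "f u = 1"
    using linear_functional_nonzero_ex[OF vs \<open>u \<noteq> 0\<close>] by blast
  define \<pi> where "\<pi> x = x - s (f x) u" for x
  have "\<forall>p\<in>J. q p = 0" if "\<forall>p\<in>J. 0 \<le> q p" "(\<Sum>p\<in>J. s (q p) (\<pi> (v p))) = 0" for q
  proof -
    have "(\<Sum>p\<in>J. s (q p) (v p)) - s (\<Sum>p\<in>J. q p * f (v p)) u = 0"
      using that(2) by (simp add: \<pi>_def scale_right_diff_distrib sum_subtractf scale_sum_left)
    then show ?thesis
      by (intro rel[OF that(1), of "\<Sum>p\<in>J. q p * f (v p)"]) simp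
  qed
  then obtain l where l: "Vector_Spaces.linear s (*) l" "\<forall>p\<in>J. 0 < l (\<pi> (v p))"
    using gordan[OF vs J, of "\<lambda>p. \<pi> (v p)"] by blast
  interpret l: Vector_Spaces.linear s "(*)" l by (rule l(1))
  have "Vector_Spaces.linear s (*) (\<lambda>x. l (\<pi> x))"
    unfolding Vector_Spaces.linear_iff
  proof (intro conjI allI vs vector_space_over_itself.vector_space_axioms)
    have "\<pi> (x + y) = \<pi> x + \<pi> y" "\<pi> (s c x) = s c (\<pi> x)" for x y c
      using f(1) by (simp_all add: Vector_Spaces.linear_iff \<pi>_def algebra_simps)
    then show "l (\<pi> (x + y)) = l (\<pi> x) + l (\<pi> y)" "l (\<pi> (s c x)) = c * l (\<pi> x)" for x y c
      using l(1) by (simp_all add: Vector_Spaces.linear_iff)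
  qed
  moreover have "l (\<pi> u) = 0"
    using f(2) l.zero by (simp add: \<pi>_def)
  ultimately show ?thesis
    using l(2) by blast
qed

section \<open>Separating points from exposing curves\<close>

lemma poly_specialize_sum_monom:
  fixes a :: "'i \<Rightarrow> 'k::comm_ring_1"
  shows "poly (specialize z (\<Sum>p\<in>A. monom (monom (a p) (f p)) (g p))) y =
    (\<Sum>p\<in>A. a p * z ^ f p * y ^ g p)"
proof -
  have "specialize z (\<Sum>p\<in>A. monom (monom (a p) (f p)) (g p)) = (\<Sum>p\<in>A. monom (a p * z ^ f p) (g p))"
    by (simp add: poly_eq_iff coeff_sum poly_sum poly_monom if_distrib[of "\<lambda>c. poly c z"] cong: if_cong)
  then show ?thesis
    by (simp add: poly_sum poly_monom)
qed

text \<open>Here \<open>j\<close> minimizes the weight \<open>m i\<close> on \<open>B\<close>, and the ratio of \<open>u\<close> and \<open>v\<close> is the one at which,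
  on the way from \<open>m i\<close> to \<open>m j\<close>, the index \<open>i\<close> stops being the only minimum on \<open>S\<close>.\<close>

lemma supporting_weight_through_two_points:
  fixes m :: "'n \<Rightarrow> 'n \<Rightarrow> nat"
  assumes "finite S" and diag: "\<And>i. m i i = 0" and off: "\<And>i p. p \<noteq> i \<Longrightarrow> 0 < m i p"
    and "i \<in> S" "B \<subseteq> S" "B \<noteq> {}" "i \<notin> B"
  shows "\<exists>j\<in>B. \<exists>q\<in>S. \<exists>u v. q \<noteq> i \<and>
    (\<forall>p\<in>S. u * m i i + v * m j i \<le> u * m i p + v * m j p) \<and>
    u * m i q + v * m j q = u * m i i + v * m j i \<and>
    (\<forall>p\<in>B. p \<noteq> j \<longrightarrow> u * m i j + v * m j j < u * m i p + v * m j p)"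
proof -
  have "finite B"
    using assms finite_subset by blast
  then obtain j where j: "j \<in> B" "\<And>p. p \<in> B \<Longrightarrow> m i j \<le> m i p"
    using \<open>B \<noteq> {}\<close> by (metis arg_min_if_finite(1) arg_min_least)
  define C where "C = {p \<in> S. m j p < m j i}"
  \<comment> \<open>Only indices in \<open>C\<close> can overtake \<open>i\<close>, and
    \<open>r p\<close> is the ratio v : u at which \<open>p\<close> ties with \<open>i\<close>. The
    least of these ratios is attained at \<open>q\<close>; clearing its denominator gives
    \<open>u\<close> and \<open>v\<close>.\<close>
  define r where "r p = rat_of_nat (m i p) / rat_of_nat (m j i - m j p)" for p
  have "j \<noteq> i"
    using j assms by blast
  then have "j \<in> C"
    using j(1) assms by (auto simp: C_def)
  moreover have "finite C"
    using assms by (simp add: C_def)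
  ultimately obtain q where q: "q \<in> C" "\<And>p. p \<in> C \<Longrightarrow> r q \<le> r p"
    by (metis arg_min_if_finite(1) arg_min_least empty_iff)
  define u where "u = m j i - m j q"
  define v where "v = m i q"
  have "q \<noteq> i"
    using q(1) by (auto simp: C_def)
  then have "0 < v"
    using off by (simp add: v_def)
  show ?thesis
  proof (intro bexI exI conjI ballI impI)
    show "j \<in> B" "q \<in> S" "q \<noteq> i"
      using j q \<open>q \<noteq> i\<close> by (auto simp: C_def)
    have "m j q \<le> m j i"
      using q(1) by (simp add: C_def)
    then show "u * m i q + v * m j q = u * m i i + v * m j i"
      unfolding u_def v_def diag by (metis add_0 add_mult_distrib2 le_add_diff_inverse2 mult.commute mult_0_right)
    show "u * m i j + v * m j j < u * m i p + v * m j p" if "p \<in> B" "p \<noteq> j" for p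
    proof -
      have "u * m i j \<le> u * m i p"
        using j(2)[OF that(1)] by simp
      moreover have "0 < v * m j p"
        using off[OF that(2)] \<open>0 < v\<close> by simp
      ultimately show ?thesis
        unfolding diag by linarith
    qed
    show "u * m i i + v * m j i \<le> u * m i p + v * m j p" if "p \<in> S" for p
    proof (cases "m j p < m j i")
      case True
      then have "r q \<le> r p"
        using q(2) that by (simp add: C_def)
      then have "rat_of_nat (m i q) * rat_of_nat (m j i - m j p) \<le> rat_of_nat (m i p) * rat_of_nat (m j i - m j q)"
        using True q(1) by (simp add: r_def C_def divide_simps mult.commute)
      then have "v * (m j i - m j p) \<le> m i p * u"
        unfolding u_def v_def of_nat_mult[symmetric] of_nat_le_iff .
      then show ?thesis
        by (simp add: diag diff_mult_distrib2 mult.commute)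
    qed (simp add: diag trans_le_add2)
  qed
qed

text \<open>The weights \<open>m i\<close> and \<open>u m i + v m j\<close> give a two-parameter family of points, with
  parameters \<open>y\<close> and \<open>z\<close>. At \<open>z = 0\<close>, after removing powers of \<open>z\<close>, at least two terms of
  \<open>\<alpha>\<close> survive, hence \<open>\<alpha>\<close> has a zero \<open>y \<noteq> 0\<close>, while \<open>\<beta>\<close> reduces to the single
  monomial with index \<open>j\<close>. The base point given by \<open>x\<close> prevents terms of \<open>\<alpha>\<close> with the
  same power of \<open>y\<close> from cancelling.\<close>

lemma separating_point_in_torus_orbit:
  fixes S0 :: "('k::alg_closed_field ^ 'n::finite) set" and m :: "'n \<Rightarrow> 'n \<Rightarrow> nat"
  assumes mult: "\<And>x y. x \<in> S0 \<Longrightarrow> y \<in> S0 \<Longrightarrow> (\<chi> p. x $ p * y $ p) \<in> S0"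
    and curve: "\<And>i z. z \<noteq> 0 \<Longrightarrow> (\<chi> p. z ^ m i p) \<in> S0"
    and diag: "\<And>i. m i i = 0" and off: "\<And>i p. p \<noteq> i \<Longrightarrow> 0 < m i p"
    and i: "\<alpha> i \<noteq> 0" "\<beta> i = 0"
    and supp: "\<And>p. \<beta> p \<noteq> 0 \<Longrightarrow> \<alpha> p \<noteq> 0" and \<beta>: "\<exists>p. \<beta> p \<noteq> 0"
  shows "\<exists>x\<in>S0. (\<Sum>p\<in>UNIV. \<alpha> p * x $ p) = 0 \<and> (\<Sum>p\<in>UNIV. \<beta> p * x $ p) \<noteq> 0"
proof -
  have m0: "m i p = 0 \<longleftrightarrow> p = i" for i p
    using diag off by (metis less_irrefl)
  define S where "S = {p. \<alpha> p \<noteq> 0}"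
  define B where "B = {p. \<beta> p \<noteq> 0}"
  have "i \<in> S" "B \<subseteq> S" "B \<noteq> {}" "i \<notin> B"
    using i supp \<beta> by (auto simp: S_def B_def)
  from supporting_weight_through_two_points[of S m, OF _ diag off this]
  have "\<exists>j\<in>B. \<exists>q\<in>S. \<exists>u v. q \<noteq> i \<and>
      (\<forall>p\<in>S. u * m i i + v * m j i \<le> u * m i p + v * m j p) \<and>
      u * m i q + v * m j q = u * m i i + v * m j i \<and>
      (\<forall>p\<in>B. p \<noteq> j \<longrightarrow> u * m i j + v * m j j < u * m i p + v * m j p)"
    by simp
  then obtain j q u v where j: "j \<in> B" and q: "q \<in> S" "q \<noteq> i"
    and min: "\<And>p. p \<in> S \<Longrightarrow> u * m i i + v * m j i \<le> u * m i p + v * m j p"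
    and tie: "u * m i q + v * m j q = u * m i i + v * m j i"
    and uniq: "\<And>p. p \<in> B \<Longrightarrow> p \<noteq> j \<Longrightarrow> u * m i j + v * m j j < u * m i p + v * m j p"
    by blast
  define e where "e p = u * m i p + v * m j p" for p
  have e: "\<And>p. p \<in> S \<Longrightarrow> e i \<le> e p" "e q = e i" "\<And>p. p \<in> B \<Longrightarrow> p \<noteq> j \<Longrightarrow> e j < e p"
    using min tie uniq by (simp_all add: e_def)
  \<comment> \<open>At z = 0 and base point \<open>x\<close>, the coefficient of y to the power
    \<open>m i q\<close> will be \<open>poly h x\<close>. Its value at \<open>x = 0\<close> is
    \<open>\<alpha> q\<close>, since \<open>m q\<close> vanishes only at \<open>q\<close>; hence it
    is nonzero for some \<open>x \<noteq> 0\<close>.\<close>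
  define N where "N = {p \<in> S. e p = e i \<and> m i p = m i q}"
  define h where "h = (\<Sum>p\<in>N. monom (\<alpha> p) (m q p))"
  have "poly h 0 = (\<Sum>p\<in>N. if p = q then \<alpha> q else 0)"
    unfolding h_def poly_sum poly_monom
    by (intro sum.cong) (simp_all add: power_0_left m0)
  also have "\<dots> = \<alpha> q"
  proof -
    have "q \<in> N"
      using q e(2) by (simp add: N_def)
    then show ?thesis
      by simp
  qed
  finally have "h \<noteq> 0"
    using q(1) by (auto simp: S_def)
  then obtain x where x: "x \<noteq> 0" "poly h x \<noteq> 0"
    using poly_nonroot_ex[of h "{0}"] by auto
  define a where "a p = \<alpha> p * x ^ m q p" for p
  define b where "b p = \<beta> p * x ^ m q p" for p
  \<comment> \<open>The lowest power of z is divided out. The least exponent is \<open>e i\<close>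
    on \<open>S\<close> and \<open>e j\<close> on \<open>B\<close>, so no subtraction is
    truncated.\<close>
  define F where "F = (\<Sum>p\<in>S. monom (monom (a p) (e p - e i)) (m i p))"
  define G where "G = (\<Sum>p\<in>B. monom (monom (b p) (e p - e j)) (m i p))"
  have coeff_F: "coeff (specialize 0 F) n = (\<Sum>p | p \<in> S \<and> e p = e i \<and> m i p = n. a p)" for n
  proof -
    have "coeff (specialize 0 F) n = (\<Sum>p\<in>S. if e p = e i \<and> m i p = n then a p else 0)"
      unfolding F_def coeff_specialize coeff_sum poly_sum
    proof (intro sum.cong refl)
      fix p assume "p \<in> S"
      then have "e p - e i = 0 \<longleftrightarrow> e p = e i"
        using e(1)[of p] by auto
      then show "poly (coeff (monom (monom (a p) (e p - e i)) (m i p)) n) 0 =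
          (if e p = e i \<and> m i p = n then a p else 0)"
        by (simp add: poly_monom power_0_left)
    qed
    then show ?thesis
      by (simp only: sum.inter_filter finite)
  qed
  \<comment> \<open>The constant term at z = 0 comes from \<open>i\<close> alone. Together with the
    coefficient at \<open>m i q\<close> it yields a root, and the root is nonzero.\<close>
  have "{p. p \<in> S \<and> e p = e i \<and> m i p = 0} = {i}"
    using \<open>i \<in> S\<close> by (auto simp: m0)
  then have F_0: "coeff (specialize 0 F) 0 \<noteq> 0"
    using i(1) x(1) unfolding coeff_F by (simp add: a_def)
  have "coeff (specialize 0 F) (m i q) = poly h x"
    unfolding coeff_F by (simp add: h_def poly_sum poly_monom a_def N_def)
  then have "m i q \<le> degree (specialize 0 F)"
    using x(2) by (metis le_degree)
  then obtain y0 where y0: "poly (specialize 0 F) y0 = 0"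
    using alg_closed_imp_poly_has_root off[OF q(2)] by (metis gr_zeroI leD)
  have "y0 \<noteq> 0"
    using y0 F_0 by (auto simp: poly_0_coeff_0)
  have "poly (specialize 0 G) y0 = (\<Sum>p\<in>B. if p = j then b j * y0 ^ m i j else 0)"
    unfolding G_def poly_specialize_sum_monom
  proof (intro sum.cong refl)
    fix p assume "p \<in> B"
    then have "e p - e j = 0 \<longleftrightarrow> p = j"
      using e(3)[of p] by (cases "p = j") auto
    then show "b p * 0 ^ (e p - e j) * y0 ^ m i p = (if p = j then b j * y0 ^ m i j else 0)"
      by (simp add: power_0_left)
  qed
  also have "\<dots> = b j * y0 ^ m i j"
    using j by simp
  finally have "poly (specialize 0 G) y0 \<noteq> 0"
    using j x(1) \<open>y0 \<noteq> 0\<close> by (simp add: b_def B_def)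
  moreover have "specialize 0 F \<noteq> 0"
    using F_0 by (metis coeff_0)
  ultimately have "\<exists>y z. y \<noteq> 0 \<and> z \<noteq> 0 \<and> poly (specialize z F) y = 0 \<and> poly (specialize z G) y \<noteq> 0"
    by (intro zero_near_specialization[OF _ y0 \<open>y0 \<noteq> 0\<close>])
  then obtain y z where yz: "y \<noteq> 0" "z \<noteq> 0"
    "poly (specialize z F) y = 0" "poly (specialize z G) y \<noteq> 0"
    by blast
  \<comment> \<open>A product of four curve points: parameter \<open>x\<close> along
    \<open>m q\<close>, \<open>y\<close> and \<open>z ^ u\<close> along \<open>m i\<close>,
    \<open>z ^ v\<close> along \<open>m j\<close>.\<close>
  define P where "P p = x ^ m q p * y ^ m i p * (z ^ u) ^ m i p * (z ^ v) ^ m j p" for p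
  have P: "P p = x ^ m q p * y ^ m i p * z ^ e p" for p
    by (simp add: P_def e_def power_add power_mult)
  have "(\<chi> p. P p) \<in> S0"
    using mult[OF mult[OF mult[OF curve[OF x(1)] curve[OF yz(1)]] curve] curve, of "z ^ u" "z ^ v"] yz(2)
    by (simp add: P_def)
  moreover have "(\<Sum>p\<in>UNIV. \<alpha> p * P p) = z ^ e i * poly (specialize z F) y"
  proof -
    have "(\<Sum>p\<in>UNIV. \<alpha> p * P p) = (\<Sum>p\<in>S. \<alpha> p * P p)"
      by (intro sum.mono_neutral_right) (auto simp: S_def)
    also have "\<dots> = z ^ e i * poly (specialize z F) y"
      unfolding F_def poly_specialize_sum_monom sum_distrib_left
    proof (intro sum.cong refl)
      fix p assume "p \<in> S"
      then have "z ^ e p = z ^ e i * z ^ (e p - e i)"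
        using e(1) by (simp flip: power_add)
      then show "\<alpha> p * P p = z ^ e i * (a p * z ^ (e p - e i) * y ^ m i p)"
        by (simp add: P a_def)
    qed
    finally show ?thesis .
  qed
  moreover have "(\<Sum>p\<in>UNIV. \<beta> p * P p) = z ^ e j * poly (specialize z G) y"
  proof -
    have "(\<Sum>p\<in>UNIV. \<beta> p * P p) = (\<Sum>p\<in>B. \<beta> p * P p)"
      by (intro sum.mono_neutral_right) (auto simp: B_def)
    also have "\<dots> = z ^ e j * poly (specialize z G) y"
      unfolding G_def poly_specialize_sum_monom sum_distrib_left
    proof (intro sum.cong refl)
      fix p assume "p \<in> B"
      then have "e j \<le> e p"
        using e(3)[of p] by (cases "p = j") auto
      then have "z ^ e p = z ^ e j * z ^ (e p - e j)"
        by (simp flip: power_add)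
      then show "\<beta> p * P p = z ^ e j * (b p * z ^ (e p - e j) * y ^ m i p)"
        by (simp add: P b_def)
    qed
    finally show ?thesis .
  qed
  ultimately show ?thesis
    using yz by (intro bexI[of _ "\<chi> p. P p"]) auto
qed

section \<open>Zariski hulls and the separation property from exposing curves\<close>

lemma zariski_hull_memI:
  assumes "\<And>f. f \<in> polynomial_functions \<Longrightarrow> (\<forall>y\<in>S. f y = 0) \<Longrightarrow> f x = 0"
  shows "x \<in> zariski_closed hull S"
  using assms unfolding hull_def zariski_closed_def by (auto simp: subset_iff)

text \<open>The curve extends to z = 0, where it passes through the coordinate vector; a polynomial
  vanishing along it for all z \<noteq> 0 also vanishes there.\<close>

lemma axis_in_zariski_hull:
  fixes S :: "('k::alg_closed_field ^ 'n::finite) set" and w :: "'n \<Rightarrow> nat"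
  assumes curve: "\<And>z. z \<noteq> 0 \<Longrightarrow> (\<chi> p. z ^ w p) \<in> S"
    and j: "w j = 0" "\<And>p. p \<noteq> j \<Longrightarrow> 0 < w p"
  shows "axis j 1 \<in> zariski_closed hull S"
proof (rule zariski_hull_memI)
  fix f :: "'k ^ 'n \<Rightarrow> 'k"
  assume "f \<in> polynomial_functions" and van: "\<forall>y\<in>S. f y = 0"
  then obtain A :: "('n \<Rightarrow> nat) set" and c where f: "\<And>x. f x = (\<Sum>a\<in>A. c a * (\<Prod>i\<in>UNIV. (x $ i) ^ a i))"
    unfolding polynomial_functions_def by blast
  define P where "P = (\<Sum>a\<in>A. monom (c a) (\<Sum>i\<in>UNIV. w i * a i))"
  have P: "poly P z = f (\<chi> p. z ^ w p)" for z
    by (simp add: P_def f poly_sum poly_monom power_sum power_mult)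
  have "P = 0"
    by (rule poly_eq_if_cofinitely_eq[of "{0}"]) (use P van curve in auto)
  then have "f (\<chi> p. 0 ^ w p) = 0"
    using P[of 0] by simp
  moreover have "w p = 0 \<longleftrightarrow> p = j" for p
    using j by (metis less_irrefl)
  then have "(\<chi> p. 0 ^ w p) = (axis j 1 :: 'k ^ 'n)"
    by (auto simp: vec_eq_iff axis_def power_0_left)
  ultimately show "f (axis j 1) = 0"
    by simp
qed

lemma linear_functional_vec_eq_sum:
  fixes \<alpha> :: "'k::field ^ 'n::finite \<Rightarrow> 'k"
  assumes "Vector_Spaces.linear (*s) (*) \<alpha>"
  shows "\<alpha> x = (\<Sum>p\<in>UNIV. \<alpha> (axis p 1) * x $ p)"
proof -
  interpret Vector_Spaces.linear "(*s)" "(*)" \<alpha> by fact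
  have "\<alpha> x = \<alpha> (\<Sum>p\<in>UNIV. x $ p *s axis p 1)"
    by (simp add: basis_expansion)
  then show ?thesis
    by (simp add: sum scale mult.commute)
qed

lemma linear_nth: "Vector_Spaces.linear (*s) (*) (\<lambda>x :: 'k::field ^ 'n. x $ i)"
  using vec.vector_space_axioms vector_space_over_itself.vector_space_axioms
  by (simp add: Vector_Spaces.linear_iff)

proposition separation_property_if_exposing_curves:
  fixes S0 :: "('k::alg_closed_field ^ 'n::finite) set" and m :: "'n \<Rightarrow> 'n \<Rightarrow> nat"
  assumes mult: "\<And>x y. x \<in> S0 \<Longrightarrow> y \<in> S0 \<Longrightarrow> (\<chi> p. x $ p * y $ p) \<in> S0"
    and curve: "\<And>i z. z \<noteq> 0 \<Longrightarrow> (\<chi> p. z ^ m i p) \<in> S0"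
    and diag: "\<And>i. m i i = 0" and off: "\<And>i p. p \<noteq> i \<Longrightarrow> 0 < m i p"
  shows "separation_property (*s) (zariski_closed hull S0)"
  unfolding separation_property_def
proof (intro allI impI)
  fix \<alpha> \<beta> :: "'k ^ 'n \<Rightarrow> 'k"
  assume lin: "Vector_Spaces.linear (*s) (*) \<alpha>" "Vector_Spaces.linear (*s) (*) \<beta>"
    and indep: "\<forall>a b. (\<forall>x. a * \<alpha> x + b * \<beta> x = 0) \<longrightarrow> a = 0 \<and> b = 0"
  define A where "A p = \<alpha> (axis p 1)" for p
  define B where "B p = \<beta> (axis p 1)" for p
  have \<alpha>: "\<alpha> x = (\<Sum>p\<in>UNIV. A p * x $ p)" and \<beta>: "\<beta> x = (\<Sum>p\<in>UNIV. B p * x $ p)" for x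
    using lin linear_functional_vec_eq_sum by (auto simp: A_def B_def)
  show "\<exists>x\<in>zariski_closed hull S0. \<alpha> x = 0 \<and> \<beta> x \<noteq> 0"
  proof (cases "\<exists>j. A j = 0 \<and> B j \<noteq> 0")
    case True
    then obtain j where "\<alpha> (axis j 1) = 0" "\<beta> (axis j 1) \<noteq> 0"
      by (auto simp: A_def B_def)
    moreover have "axis j 1 \<in> zariski_closed hull S0"
      by (rule axis_in_zariski_hull[of "m j"]) (use curve diag off in auto)
    ultimately show ?thesis
      by blast
  next
    case False
    obtain i where i: "A i \<noteq> 0"
    proof (rule ccontr)
      assume "\<not> thesis"
      with that have "A p = 0" for p
        by blast
      then have "\<forall>x. 1 * \<alpha> x + 0 * \<beta> x = 0"
        by (simp add: \<alpha>)
      then show False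
        using indep[THEN spec, THEN spec, of 1 0] by simp
    qed
    \<comment> \<open>This multiple makes the coefficient at \<open>i\<close> vanish, while the
      values of \<open>\<beta>\<close> at zeros of \<open>\<alpha>\<close> stay unchanged.\<close>
    define r where "r = B i / A i"
    define B' where "B' p = B p - r * A p" for p
    have B': "(\<Sum>p\<in>UNIV. B' p * x $ p) = \<beta> x - r * \<alpha> x" for x
      by (simp add: \<alpha> \<beta> B'_def left_diff_distrib sum_subtractf sum_distrib_left mult.assoc)
    have "\<exists>p. B' p \<noteq> 0"
    proof (rule ccontr)
      assume "\<nexists>p. B' p \<noteq> 0"
      then have "\<forall>x. (- r) * \<alpha> x + 1 * \<beta> x = 0"
        using B' by simp
      then show False
        using indep[THEN spec, THEN spec, of "- r" 1] by simp
    qed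
    moreover have "B' i = 0"
      using i by (simp add: B'_def r_def)
    moreover have "A p \<noteq> 0" if "B' p \<noteq> 0" for p
      using that False by (auto simp: B'_def)
    ultimately obtain x where "x \<in> S0" "(\<Sum>p\<in>UNIV. A p * x $ p) = 0" "(\<Sum>p\<in>UNIV. B' p * x $ p) \<noteq> 0"
      using separating_point_in_torus_orbit[of S0 m A i B', OF mult curve diag off] i by blast
    then show ?thesis
      using \<alpha> B' by (intro bexI[of _ x]) (auto intro: hull_inc)
  qed
qed

section \<open>Characters and cocharacters of a torus\<close>

lemma carrier_Gm [simp]: "carrier Gm = {x. x \<noteq> 0}"
  by (simp add: Gm_def)

lemma mult_Gm [simp]: "x \<otimes>\<^bsub>Gm\<^esub> y = x * y"
  by (simp add: Gm_def)

lemma power_int_sum: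
  assumes "(x :: 'k::field) \<noteq> 0"
  shows "x powi (\<Sum>p\<in>P. f p) = (\<Prod>p\<in>P. x powi f p)"
  using assms by (induction P rule: infinite_finite_induct) (simp_all add: power_int_add)

lemma prod_power_int_distrib:
  "(\<Prod>p\<in>P. f p) powi n = (\<Prod>p\<in>P. (f p :: 'k::field) powi n)"
  by (induction P rule: infinite_finite_induct) (simp_all add: power_int_mult_distrib)

lemma common_denominator:
  assumes "finite J"
  shows "\<exists>N>0. \<forall>j\<in>J. \<exists>n. of_nat N * (f j :: rat) = of_int n"
  using assms
proof induction
  case empty
  show ?case
    by (intro exI[of _ 1]) simp
next
  case (insert j J)
  then obtain N where N: "N > 0" "\<forall>j\<in>J. \<exists>n. of_nat N * f j = of_int n"
    by blast
  obtain a b where ab: "f j = of_int a / of_int b" "b > 0"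
    by (metis quotient_of_denom_pos quotient_of_div surj_pair)
  have b: "rat_of_nat (nat b) = of_int b"
    using ab(2) by simp
  show ?case
  proof (intro exI[of _ "nat b * N"] conjI ballI)
    show "nat b * N > 0"
      using N(1) ab(2) by simp
    fix i assume i: "i \<in> insert j J"
    show "\<exists>n. of_nat (nat b * N) * f i = of_int n"
    proof (cases "i = j")
      case True
      then have "of_nat (nat b * N) * f i = of_int (int N * a)"
        using ab unfolding of_nat_mult b by simp
      then show ?thesis ..
    next
      case False
      then obtain n where "of_nat N * f i = of_int n"
        using i N(2) by blast
      then have "of_nat (nat b * N) * f i = of_int (b * n)"
        unfolding of_nat_mult b by simp
      then show ?thesis ..
    qed
  qed
qed

text \<open>Artin's argument: translating the relation by \<open>u\<close> and subtracting
  \<open>\<theta> u\<close> times the original eliminates \<open>\<theta>\<close> and leaves the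
  coefficients \<open>c \<psi> * (\<psi> u - \<theta> u)\<close>. Extensionality ensures that
  distinct characters differ at some \<open>u\<close> in the group.\<close>

lemma dedekind_independence:
  fixes C :: "('t \<Rightarrow> 'k::field) set"
  assumes "finite C" and "C \<subseteq> hom G Gm \<inter> extensional (carrier G)" and "group G"
    and "\<And>t. t \<in> carrier G \<Longrightarrow> (\<Sum>\<psi>\<in>C. c \<psi> * \<psi> t) = 0"
  shows "\<forall>\<psi>\<in>C. c \<psi> = 0"
  using assms(1,2,4)
proof (induction C arbitrary: c rule: finite_induct)
  case (insert \<theta> C)
  interpret group G by fact
  have \<theta>: "\<theta> (u \<otimes>\<^bsub>G\<^esub> t) = \<theta> u * \<theta> t" "\<theta> t \<noteq> 0" if "u \<in> carrier G" "t \<in> carrier G" for u t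
    using insert.prems(1) that by (auto simp: hom_def Pi_def)
  have mult: "\<psi> (u \<otimes>\<^bsub>G\<^esub> t) = \<psi> u * \<psi> t" if "\<psi> \<in> C" "u \<in> carrier G" "t \<in> carrier G" for u t \<psi>
    using insert.prems(1) that by (auto simp: hom_def Pi_def)
  have "\<forall>\<psi>\<in>C. c \<psi> * (\<psi> u - \<theta> u) = 0" if u: "u \<in> carrier G" for u
  proof (rule insert.IH)
    show "C \<subseteq> hom G Gm \<inter> extensional (carrier G)"
      using insert.prems(1) by blast
    fix t assume t: "t \<in> carrier G"
    have "c \<theta> * \<theta> (u \<otimes>\<^bsub>G\<^esub> t) + (\<Sum>\<psi>\<in>C. c \<psi> * \<psi> (u \<otimes>\<^bsub>G\<^esub> t)) = 0"
      "c \<theta> * \<theta> t + (\<Sum>\<psi>\<in>C. c \<psi> * \<psi> t) = 0"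
      using insert.prems(2)[of "u \<otimes>\<^bsub>G\<^esub> t"] insert.prems(2)[of t] insert.hyps u t by simp_all
    moreover have "(\<Sum>\<psi>\<in>C. c \<psi> * \<psi> (u \<otimes>\<^bsub>G\<^esub> t)) = (\<Sum>\<psi>\<in>C. c \<psi> * (\<psi> u * \<psi> t))"
      using mult u t by (intro sum.cong) auto
    moreover have "(\<Sum>\<psi>\<in>C. c \<psi> * (\<psi> u - \<theta> u) * \<psi> t) =
        (\<Sum>\<psi>\<in>C. c \<psi> * (\<psi> u * \<psi> t)) - \<theta> u * (\<Sum>\<psi>\<in>C. c \<psi> * \<psi> t)"
      unfolding sum_distrib_left sum_subtractf[symmetric] by (intro sum.cong) (simp_all add: algebra_simps)
    ultimately show "(\<Sum>\<psi>\<in>C. c \<psi> * (\<psi> u - \<theta> u) * \<psi> t) = 0"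
      using \<theta>(1)[OF u t] by algebra
  qed
  moreover have "\<exists>u\<in>carrier G. \<psi> u \<noteq> \<theta> u" if "\<psi> \<in> C" for \<psi>
    using insert.prems(1) insert.hyps(2) that extensionalityI[of \<psi> "carrier G" \<theta>] by blast
  ultimately have C: "\<forall>\<psi>\<in>C. c \<psi> = 0"
    by (metis mult_eq_0_iff right_minus_eq)
  then have "c \<theta> * \<theta> \<one>\<^bsub>G\<^esub> = 0"
    using insert.prems(2)[of "\<one>\<^bsub>G\<^esub>"] insert.hyps by simp
  then show ?case
    using C \<theta>(2)[of "\<one>\<^bsub>G\<^esub>" "\<one>\<^bsub>G\<^esub>"] by simp
qed simp

text \<open>One isomorphism with a power of \<open>Gm\<close> is fixed, so that characters and
  cocharacters get coordinates.\<close>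

locale coordinatized_torus =
  fixes T :: "('t, 'm) monoid_scheme" and R :: "('t \<Rightarrow> 'k::alg_closed_field) set"
    and r :: nat and \<phi> :: "'t \<Rightarrow> nat \<Rightarrow> 'k"
  assumes group_T: "group T"
    and iso_\<phi>: "\<phi> \<in> iso T (Gm_power r)"
    and R_eq: "R = {f. \<exists>g\<in>laurent_functions r. \<forall>t\<in>carrier T. f t = g (\<phi> t)}"
begin

sublocale T: group T
  by (rule group_T)

abbreviation \<Lambda> :: "('t \<Rightarrow> 'k) monoid" where
  "\<Lambda> \<equiv> character_group T R"

text \<open>Laurent monomials pulled back to \<open>T\<close>. Entries of \<open>a\<close> from
  \<open>r\<close> on are ignored, so distinct \<open>a\<close> may give the same character.\<close>

definition mono_char :: "(nat \<Rightarrow> int) \<Rightarrow> 't \<Rightarrow> 'k" where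
  "mono_char a = (\<lambda>t\<in>carrier T. \<Prod>j<r. \<phi> t j powi a j)"

lemma \<phi>_closed: "t \<in> carrier T \<Longrightarrow> \<phi> t \<in> carrier (Gm_power r)"
  using iso_\<phi> by (auto simp: iso_def hom_def)

lemma \<phi>_nonzero: "t \<in> carrier T \<Longrightarrow> j < r \<Longrightarrow> \<phi> t j \<noteq> 0"
  using \<phi>_closed by auto

lemma \<phi>_mult: "t \<in> carrier T \<Longrightarrow> u \<in> carrier T \<Longrightarrow> j < r \<Longrightarrow> \<phi> (t \<otimes>\<^bsub>T\<^esub> u) j = \<phi> t j * \<phi> u j"
  using iso_\<phi> by (auto simp: iso_def hom_def)

lemma point_ex:
  assumes "\<And>j. j < r \<Longrightarrow> w j \<noteq> 0"
  obtains t where "t \<in> carrier T" "\<And>j. j < r \<Longrightarrow> \<phi> t j = w j"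
proof -
  have "restrict w {..<r} \<in> carrier (Gm_power r)"
    using assms by auto
  moreover have "\<phi> ` carrier T = carrier (Gm_power r)"
    using iso_\<phi> by (simp add: iso_def bij_betw_def)
  ultimately obtain t where "t \<in> carrier T" "\<phi> t = restrict w {..<r}"
    by (metis imageE)
  then show thesis
    by (intro that[of t]) auto
qed

lemma mono_char_nonzero: "t \<in> carrier T \<Longrightarrow> mono_char a t \<noteq> 0"
  by (simp add: mono_char_def \<phi>_nonzero)

lemma mono_char_in_hom: "mono_char a \<in> hom T Gm \<inter> extensional (carrier T)"
  using mono_char_nonzero
  by (auto simp: hom_def mono_char_def \<phi>_mult power_int_mult_distrib prod.distrib)

lemma mono_char_in_character_group: "mono_char a \<in> carrier \<Lambda>"
proof -
  have "(\<lambda>x. \<Prod>i<r. x i powi a i) \<in> laurent_functions r"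
    unfolding laurent_functions_def by (intro CollectI exI[of _ "{a}"] exI[of _ "\<lambda>_. 1"]) simp
  then have "mono_char a \<in> R"
    unfolding R_eq by (auto simp: mono_char_def)
  then show ?thesis
    using mono_char_in_hom by (simp add: character_group_def)
qed

text \<open>A character is a linear combination of monomial characters, so it is one of them.\<close>

lemma character_is_mono_char:
  assumes "\<theta> \<in> carrier \<Lambda>"
  obtains a where "\<theta> = mono_char a"
proof (cases "\<theta> \<in> range mono_char")
  case False
  have \<theta>: "\<theta> \<in> hom T Gm \<inter> extensional (carrier T)" "\<theta> \<in> R"
    using assms by (auto simp: character_group_def)
  then obtain g where g: "g \<in> laurent_functions r" "\<forall>t\<in>carrier T. \<theta> t = g (\<phi> t)"
    unfolding R_eq by blast
  then obtain A :: "(nat \<Rightarrow> int) set" and c where A: "finite A"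
    "\<forall>x\<in>carrier (Gm_power r). g x = (\<Sum>a\<in>A. c a * (\<Prod>i<r. x i powi a i))"
    unfolding laurent_functions_def by blast
  \<comment> \<open>The expansion of \<open>\<theta>\<close> is read as a relation with coefficient
    -1 at \<open>\<theta>\<close>. Exponents giving the same character are grouped, as independence
    concerns distinct characters.\<close>
  define d where "d \<psi> = (if \<psi> = \<theta> then - 1 else \<Sum>a | a \<in> A \<and> mono_char a = \<psi>. c a)" for \<psi>
  have "\<forall>\<psi>\<in>insert \<theta> (mono_char ` A). d \<psi> = 0"
  proof (rule dedekind_independence)
    show "finite (insert \<theta> (mono_char ` A))"
      using A(1) by simp
    show "insert \<theta> (mono_char ` A) \<subseteq> hom T Gm \<inter> extensional (carrier T)"
      using \<theta> mono_char_in_hom by blast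
    fix t assume t: "t \<in> carrier T"
    have "\<theta> t = (\<Sum>a\<in>A. c a * mono_char a t)"
      using A(2) g(2) t \<phi>_closed[OF t] by (simp add: mono_char_def del: carrier_product_group)
    also have "\<dots> = (\<Sum>\<psi>\<in>mono_char ` A. \<Sum>a | a \<in> A \<and> mono_char a = \<psi>. c a * mono_char a t)"
      by (rule sum.image_gen[OF A(1)])
    also have "\<dots> = (\<Sum>\<psi>\<in>mono_char ` A. d \<psi> * \<psi> t)"
      using False by (intro sum.cong) (auto simp: d_def sum_distrib_right)
    finally show "(\<Sum>\<psi>\<in>insert \<theta> (mono_char ` A). d \<psi> * \<psi> t) = 0"
      using False A(1) by (subst sum.insert) (auto simp: d_def)
  qed (rule group_T)
  then show thesis
    by (simp add: d_def)
qed (use that in blast)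

lemma mono_char_add: "mono_char (\<lambda>j. a j + b j) = mono_char a \<otimes>\<^bsub>\<Lambda>\<^esub> mono_char b"
  by (auto simp: mono_char_def character_group_def power_int_add \<phi>_nonzero prod.distrib)

lemma mono_char_cong: "(\<And>j. j < r \<Longrightarrow> a j = b j) \<Longrightarrow> mono_char a = mono_char b"
  by (auto simp: mono_char_def intro!: prod.cong ext)

text \<open>The torus is divisible: \<open>t\<close> has a d-th root \<open>u\<close>, found
  coordinatewise, so the character at \<open>t\<close> equals its d-th power at \<open>u\<close>.
  Thus the character group is torsion-free.\<close>

lemma mono_char_eq_one_if_power_eq_one:
  assumes "mono_char a [^]\<^bsub>\<Lambda>\<^esub> (d :: nat) = \<one>\<^bsub>\<Lambda>\<^esub>" "d > 0"
  shows "mono_char a = \<one>\<^bsub>\<Lambda>\<^esub>"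
proof
  fix t
  show "mono_char a t = \<one>\<^bsub>\<Lambda>\<^esub> t"
  proof (cases "t \<in> carrier T")
    case True
    have "\<exists>y. y ^ d = \<phi> t j" for j
      using nth_root_exists[OF assms(2), of "\<phi> t j"] by auto
    then obtain w where w: "\<And>j. w j ^ d = \<phi> t j"
      by metis
    then have "w j \<noteq> 0" if "j < r" for j
      using \<phi>_nonzero[OF True that] assms(2) by (metis power_0_left less_irrefl)
    then obtain u where u: "u \<in> carrier T" "\<And>j. j < r \<Longrightarrow> \<phi> u j = w j"
      using point_ex by blast
    have pow: "(\<theta> [^]\<^bsub>\<Lambda>\<^esub> n) u = \<theta> u ^ n" for \<theta> and n :: nat
      using u(1) by (induction n) (simp_all add: character_group_def)
    have "(w j ^ d) powi a j = (w j powi a j) ^ d" for j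
      by (simp add: power_int_power power_int_power' mult.commute)
    then have "mono_char a t = (\<Prod>j<r. (w j powi a j) ^ d)"
      using True by (simp add: mono_char_def flip: w)
    also have "\<dots> = mono_char a u ^ d"
      using u by (simp add: mono_char_def prod_power_distrib)
    also have "\<dots> = 1"
      using arg_cong[OF assms(1), of "\<lambda>f. f u"] u(1) unfolding pow by (simp add: character_group_def)
    finally show ?thesis
      using True by (simp add: character_group_def)
  qed (simp add: mono_char_def character_group_def)
qed

section \<open>Relations and cocharacters after extension to the rationals\<close>

context
  fixes s :: "rat \<Rightarrow> 'w::ab_group_add \<Rightarrow> 'w" and \<iota> :: "('t \<Rightarrow> 'k) \<Rightarrow> 'w"
  assumes rat: "rationalization \<Lambda> s \<iota>"
begin

interpretation W: vector_space s
  using rat by (simp add: rationalization_def)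

lemma \<iota>_add: "\<iota> (mono_char (\<lambda>j. a j + b j)) = \<iota> (mono_char a) + \<iota> (mono_char b)"
  using rat mono_char_in_character_group by (simp add: rationalization_def mono_char_add)

lemma \<iota>_zero: "\<iota> (mono_char (\<lambda>_. 0)) = 0"
  using \<iota>_add[of "\<lambda>_. 0" "\<lambda>_. 0"] by simp

lemma \<iota>_sum: "\<iota> (mono_char (\<lambda>j. \<Sum>p\<in>P. f p j)) = (\<Sum>p\<in>P. \<iota> (mono_char (f p)))"
  by (induction P rule: infinite_finite_induct) (simp_all add: \<iota>_zero \<iota>_add)

lemma \<iota>_scale: "\<iota> (mono_char (\<lambda>j. k * a j)) = s (of_int k) (\<iota> (mono_char a))"
proof -
  have nat: "\<iota> (mono_char (\<lambda>j. int n * a j)) = s (of_nat n) (\<iota> (mono_char a))" for n a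
    by (induction n) (simp_all add: \<iota>_zero \<iota>_add ring_distribs W.scale_left_distrib)
  have neg: "\<iota> (mono_char (\<lambda>j. - b j)) = - \<iota> (mono_char b)" for b
    using \<iota>_add[of "\<lambda>j. - b j" b] by (simp add: \<iota>_zero eq_neg_iff_add_eq_0)
  show ?thesis
    using nat neg by (cases k rule: int_cases2) auto
qed

lemma \<iota>_coordinates:
  "\<iota> (mono_char a) = (\<Sum>j<r. s (of_int (a j)) (\<iota> (mono_char (\<lambda>i. of_bool (i = j)))))"
proof -
  have "mono_char a = mono_char (\<lambda>i. \<Sum>j<r. a j * of_bool (i = j))"
    by (rule mono_char_cong) (simp add: of_bool_def if_distrib cong: if_cong)
  then show ?thesis
    by (simp only: \<iota>_sum \<iota>_scale)
qed

lemma \<iota>_eq_0_imp_one: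
  assumes "\<theta> \<in> carrier \<Lambda>" "\<iota> \<theta> = 0"
  shows "\<theta> = \<one>\<^bsub>\<Lambda>\<^esub>"
proof -
  obtain d :: nat where "d > 0" "\<theta> [^]\<^bsub>\<Lambda>\<^esub> d = \<one>\<^bsub>\<Lambda>\<^esub>"
    using rat assms unfolding rationalization_def by blast
  then show ?thesis
    using mono_char_eq_one_if_power_eq_one character_is_mono_char[OF assms(1)] by metis
qed

text \<open>As \<open>\<iota>\<close> kills only the trivial character, an integral relation among
  weights already holds in the character group and can be evaluated at \<open>t\<close>.\<close>

lemma monomial_relation:
  assumes c: "\<And>p. c p \<in> carrier \<Lambda>" and rel: "(\<Sum>p\<in>P. s (of_int (k p)) (\<iota> (c p))) = 0"
    and t: "t \<in> carrier T"
  shows "(\<Prod>p\<in>P. c p t powi k p) = 1"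
proof -
  have "\<exists>a. c p = mono_char a" for p
    using character_is_mono_char[OF c] by metis
  then obtain A where A: "\<And>p. c p = mono_char (A p)"
    by metis
  define \<theta> where "\<theta> = mono_char (\<lambda>j. \<Sum>p\<in>P. k p * A p j)"
  have "\<iota> \<theta> = 0"
    using rel by (simp add: \<theta>_def \<iota>_sum \<iota>_scale A)
  then have "\<theta> = \<one>\<^bsub>\<Lambda>\<^esub>"
    using \<iota>_eq_0_imp_one mono_char_in_character_group by (simp add: \<theta>_def)
  then have "1 = \<theta> t"
    using t by (simp add: character_group_def)
  also have "\<dots> = (\<Prod>j<r. \<Prod>p\<in>P. (\<phi> t j powi A p j) powi k p)"
  proof -
    have "\<phi> t j powi (k p * A p j) = (\<phi> t j powi A p j) powi k p" for j p
      by (metis mult.commute power_int_mult)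
    then show ?thesis
      using t by (simp add: \<theta>_def mono_char_def power_int_sum \<phi>_nonzero)
  qed
  also have "\<dots> = (\<Prod>p\<in>P. \<Prod>j<r. (\<phi> t j powi A p j) powi k p)"
    by (rule prod.swap)
  also have "\<dots> = (\<Prod>p\<in>P. c p t powi k p)"
    using t by (simp add: A mono_char_def prod_power_int_distrib)
  finally show ?thesis ..
qed

text \<open>A common denominator \<open>N\<close> makes the values of \<open>l\<close> at the
  coordinate characters integral; these integers are the exponents of the cocharacter
  \<open>\<gamma>\<close>, and \<open>e\<close> is its pairing with \<open>\<theta>\<close>.\<close>

lemma cocharacter_of_functional:
  assumes "Vector_Spaces.linear s (*) l"
  obtains N :: nat and \<gamma> where "N > 0" "\<And>z. z \<noteq> 0 \<Longrightarrow> \<gamma> z \<in> carrier T"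
    "\<And>\<theta>. \<theta> \<in> carrier \<Lambda> \<Longrightarrow> \<exists>e. of_nat N * l (\<iota> \<theta>) = of_int e \<and> (\<forall>z. z \<noteq> 0 \<longrightarrow> \<theta> (\<gamma> z) = z powi e)"
proof -
  interpret l: Vector_Spaces.linear s "(*)" l by fact
  define h where "h j = l (\<iota> (mono_char (\<lambda>i. of_bool (i = j))))" for j
  obtain N where N: "N > 0" "\<forall>j\<in>{..<r}. \<exists>n. of_nat N * h j = of_int n"
    using common_denominator[of "{..<r}" h] by blast
  then obtain n where n: "\<And>j. j < r \<Longrightarrow> of_nat N * h j = of_int (n j)"
    by (metis lessThan_iff)
  have "\<exists>t\<in>carrier T. \<forall>j<r. \<phi> t j = z powi n j" if "z \<noteq> 0" for z
    using point_ex[of "\<lambda>j. z powi n j"] that by (metis power_int_eq_0_iff)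
  then obtain \<gamma> where \<gamma>: "\<And>z. z \<noteq> 0 \<Longrightarrow> \<gamma> z \<in> carrier T" "\<And>z j. z \<noteq> 0 \<Longrightarrow> j < r \<Longrightarrow> \<phi> (\<gamma> z) j = z powi n j"
    by metis
  show thesis
  proof (rule that[OF N(1) \<gamma>(1)])
    fix \<theta> assume "\<theta> \<in> carrier \<Lambda>"
    then obtain a where a: "\<theta> = mono_char a"
      using character_is_mono_char by blast
    have "of_nat N * l (\<iota> \<theta>) = (\<Sum>j<r. of_int (a j) * (of_nat N * h j))"
      unfolding a by (subst \<iota>_coordinates) (simp add: l.sum l.scale h_def sum_distrib_left mult.left_commute)
    also have "\<dots> = of_int (\<Sum>j<r. n j * a j)"
      by (simp add: n mult.commute)
    finally have "of_nat N * l (\<iota> \<theta>) = of_int (\<Sum>j<r. n j * a j)" .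
    moreover have "\<theta> (\<gamma> z) = z powi (\<Sum>j<r. n j * a j)" if "z \<noteq> 0" for z
      using that \<gamma> by (simp add: a mono_char_def power_int_sum power_int_mult)
    ultimately show "\<exists>e. of_nat N * l (\<iota> \<theta>) = of_int e \<and> (\<forall>z. z \<noteq> 0 \<longrightarrow> \<theta> (\<gamma> z) = z powi e)"
      by blast
  qed
qed

end

end

section \<open>The cone of weights\<close>

lemma functional_nonneg_on_cone:
  assumes "Vector_Spaces.linear s (*) l" "\<And>p. 0 \<le> l (v p)" "x \<in> cone_generated s v"
  shows "0 \<le> l x"
proof -
  interpret l: Vector_Spaces.linear s "(*)" l by fact
  show ?thesis
    using assms(2,3) by (auto simp: cone_generated_def l.sum l.scale intro!: sum_nonneg mult_nonneg_nonneg)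
qed

text \<open>An affine function of \<open>q\<close> with nonzero slope takes the value -1.\<close>

lemma functional_nonneg_on_line:
  assumes "Vector_Spaces.linear s (*) l" "\<And>q :: rat. 0 \<le> l (w + s q d)"
  shows "l d = 0"
proof (rule ccontr)
  assume d: "l d \<noteq> 0"
  interpret l: Vector_Spaces.linear s "(*)" l by fact
  have "l (w + s (- (l w + 1) / l d) d) = -1"
    unfolding l.add l.scale using d by simp
  then show False
    using assms(2)[of "- (l w + 1) / l d"] by simp
qed

text \<open>If \<open>d\<close> is a direction of a line in the cone and \<open>f d = 1\<close>, then both \<open>L\<close> and
  \<open>C L + f\<close> with \<open>C\<close> large are nonnegative on the line, hence vanish on \<open>d\<close>.\<close>

lemma strictly_convex_if_positive_functional:
  assumes vs: "vector_space s" and L: "Vector_Spaces.linear s (*) L"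
    and pos: "\<And>p. v p \<noteq> 0 \<Longrightarrow> 0 < L (v p)"
  shows "strictly_convex s (cone_generated s v)"
  unfolding strictly_convex_def
proof (rule notI, elim exE conjE)
  fix w d assume d: "d \<noteq> 0" and line: "range (\<lambda>q. w + s q d) \<subseteq> cone_generated s v"
  interpret L: Vector_Spaces.linear s "(*)" L by fact
  obtain f where f: "Vector_Spaces.linear s (*) f" "f d = 1"
    using linear_functional_nonzero_ex[OF vs d] by blast
  interpret f: Vector_Spaces.linear s "(*)" f by (rule f(1))
  have vanish: "l d = 0" if "Vector_Spaces.linear s (*) l" "\<And>p. 0 \<le> l (v p)" for l
    using functional_nonneg_on_line functional_nonneg_on_cone line that by (metis rangeI subsetD)
  define C where "C = (\<Sum>p\<in>UNIV. \<bar>f (v p)\<bar> / L (v p))"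
  define g where "g x = C * L x + f x" for x
  have L0: "0 \<le> L (v p)" for p
    using pos[of p] L.zero by (cases "v p = 0") auto
  have "0 \<le> g (v p)" for p
  proof (cases "v p = 0")
    case True
    then show ?thesis
      by (simp add: g_def L.zero f.zero)
  next
    case False
    have "\<bar>f (v p)\<bar> / L (v p) \<le> C"
      unfolding C_def by (rule member_le_sum) (auto simp: L0)
    then have "\<bar>f (v p)\<bar> \<le> C * L (v p)"
      using pos[OF False] by (simp add: pos_divide_le_eq)
    then show ?thesis
      by (simp add: g_def)
  qed
  moreover have "Vector_Spaces.linear s (*) g"
    using vs vector_space_over_itself.vector_space_axioms
    by (auto simp: Vector_Spaces.linear_iff g_def L.add L.scale f.add f.scale algebra_simps)
  ultimately have "g d = 0" "L d = 0"
    using vanish L L0 by blast+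
  then show False
    using f(2) by (simp add: g_def)
qed

lemma generator_in_ray: "vector_space s \<Longrightarrow> v \<in> ray s v"
  unfolding ray_def by (intro CollectI exI[of _ 1]) (simp add: vector_space.vector_space_assms(4))

lemma ray_subset_cone:
  assumes "vector_space s"
  shows "ray s (v i) \<subseteq> cone_generated s v"
proof
  interpret vector_space s by fact
  fix x assume "x \<in> ray s (v i)"
  then obtain q where q: "0 \<le> q" "x = s q (v i)"
    by (auto simp: ray_def)
  have "(\<Sum>p\<in>UNIV. s (if p = i then q else 0) (v p)) = (\<Sum>p\<in>UNIV. if p = i then s q (v i) else 0)"
    by (intro sum.cong) auto
  then show "x \<in> cone_generated s v"
    using q unfolding cone_generated_def
    by (intro CollectI exI[of _ "\<lambda>p. if p = i then q else 0"]) auto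
qed

lemma dim_ray:
  assumes "vector_space s" "v \<noteq> 0"
  shows "vector_space.dim s (ray s v) = 1"
proof -
  interpret vector_space s by fact
  show ?thesis
  proof (rule dim_unique[of "{v}"])
    show "{v} \<subseteq> ray s v"
      using generator_in_ray[OF assms(1)] by simp
    show "ray s v \<subseteq> span {v}"
      by (auto simp: ray_def intro: span_scale span_base)
    show "independent {v}"
      using assms(2) by (simp add: dependent_single)
  qed simp
qed

text \<open>The exposing functional cuts out the face: on a nonnegative combination it vanishes only
  if all coefficients off \<open>i\<close> do.\<close>

lemma is_edge_ray_if_exposed:
  assumes vs: "vector_space s" and "v i \<noteq> 0" and l: "Vector_Spaces.linear s (*) l"
    and li: "l (v i) = 0" and lp: "\<And>p. p \<noteq> i \<Longrightarrow> 0 < l (v p)"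
  shows "is_edge s (cone_generated s v) (ray s (v i))"
proof -
  interpret vector_space s by fact
  interpret l: Vector_Spaces.linear s "(*)" l by fact
  have nonneg: "0 \<le> l (v p)" for p
    using li lp by (cases "p = i") (auto intro: less_imp_le)
  have "x \<in> ray s (v i)" if "x \<in> cone_generated s v" "l x = 0" for x
  proof -
    have "\<exists>q. x = (\<Sum>p\<in>UNIV. s (q p) (v p)) \<and> (\<forall>p. 0 \<le> q p)"
      using that(1) by (simp add: cone_generated_def)
    then obtain q where q: "x = (\<Sum>p\<in>UNIV. s (q p) (v p))" "\<forall>p. 0 \<le> q p"
      by (elim exE conjE) (rule that)
    have "(\<Sum>p\<in>UNIV. q p * l (v p)) = 0"
      using that(2) by (simp add: q(1) l.sum l.scale)
    then have "\<forall>p\<in>UNIV. q p * l (v p) = 0"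
      by (subst (asm) sum_nonneg_eq_0_iff) (auto simp: q(2) nonneg)
    then have "q p = 0" if "p \<noteq> i" for p
      using lp[OF that] by (auto dest: spec[of _ p])
    then have "x = (\<Sum>p\<in>UNIV. if p = i then s (q i) (v i) else 0)"
      unfolding q(1) by (intro sum.cong) auto
    then show ?thesis
      using q(2) by (auto simp: ray_def)
  qed
  moreover have "l x = 0" if "x \<in> ray s (v i)" for x
    using that li by (auto simp: ray_def l.scale)
  ultimately have "ray s (v i) = {x \<in> cone_generated s v. l x = 0}"
    using ray_subset_cone[OF vs, of v i] by blast
  then show ?thesis
    unfolding is_edge_def is_face_def
    using l dim_ray[OF vs \<open>v i \<noteq> 0\<close>] functional_nonneg_on_cone[where v = v, OF l nonneg] by blast
qed

lemma is_edge_ray_imp_nonzero: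
  assumes vs: "vector_space s" and edge: "is_edge s K (ray s v)"
  shows "v \<noteq> 0"
proof
  interpret vector_space s by fact
  assume "v = 0"
  then have "ray s v = {0}"
    by (auto simp: ray_def)
  moreover have "dim {0} = 0"
    using independent_empty by (intro dim_unique[of "{}"]) (auto simp: span_zero)
  ultimately show False
    using edge by (simp add: is_edge_def)
qed

text \<open>The functional defining the face works: a further generator in its kernel would lie on
  the ray of \<open>v i\<close>, hence be a positive multiple of \<open>v i\<close> and span the
  same ray.\<close>

lemma exposed_if_is_edge_ray:
  assumes vs: "vector_space s" and edge: "is_edge s (cone_generated s v) (ray s (v i))"
    and nonzero: "\<And>p. v p \<noteq> 0" and distinct: "\<And>p. p \<noteq> i \<Longrightarrow> ray s (v p) \<noteq> ray s (v i)"
  shows "\<exists>l. Vector_Spaces.linear s (*) l \<and> l (v i) = 0 \<and> (\<forall>p. p \<noteq> i \<longrightarrow> 0 < l (v p))"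
proof -
  interpret vector_space s by fact
  obtain l where l: "Vector_Spaces.linear s (*) l" "\<forall>x\<in>cone_generated s v. 0 \<le> l x"
    "ray s (v i) = {x \<in> cone_generated s v. l x = 0}"
    using edge by (auto simp: is_edge_def is_face_def)
  have mem: "v p \<in> cone_generated s v" for p
    using ray_subset_cone[OF vs] generator_in_ray[OF vs] by blast
  have "0 < l (v p)" if "p \<noteq> i" for p
  proof (rule ccontr)
    assume "\<not> 0 < l (v p)"
    then have "v p \<in> ray s (v i)"
      using l(2,3) mem[of p] by force
    then obtain q where q: "0 \<le> q" "v p = s q (v i)"
      by (auto simp: ray_def)
    then have "0 < q"
      using nonzero[of p] by (cases "q = 0") auto
    have "s a (v i) \<in> ray s (v p)" if "0 \<le> a" for a
      unfolding ray_def q(2) using that \<open>0 < q\<close> by (intro CollectI exI[of _ "a / q"]) simp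
    moreover have "s a (v p) \<in> ray s (v i)" if "0 \<le> a" for a
      unfolding ray_def q(2) using that \<open>0 < q\<close> by (intro CollectI exI[of _ "a * q"]) simp
    ultimately have "ray s (v p) = ray s (v i)"
      by (auto simp: ray_def)
    then show False
      using distinct[OF that] by simp
  qed
  moreover have "l (v i) = 0"
    using l(3) generator_in_ray[OF vs, of "v i"] by blast
  ultimately show ?thesis
    using l(1) by blast
qed

section \<open>Binomial equations and coordinate functionals\<close>

lemma binomial_on_zariski_hull:
  fixes S :: "('k::field ^ 'n::finite) set" and a b :: "'n \<Rightarrow> nat"
  assumes S: "\<And>y. y \<in> S \<Longrightarrow> (\<Prod>p\<in>UNIV. (y $ p) ^ a p) = (\<Prod>p\<in>UNIV. (y $ p) ^ b p)"
    and "x \<in> zariski_closed hull S"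
  shows "(\<Prod>p\<in>UNIV. (x $ p) ^ a p) = (\<Prod>p\<in>UNIV. (x $ p) ^ b p)"
\<comment> \<open>For equal exponents the set \<open>{a, b}\<close> has a single element and cannot
  carry both coefficients 1 and -1.\<close>
proof (cases "a = b")
  case False
  define f where "f x = (\<Prod>p\<in>UNIV. (x $ p) ^ a p) - (\<Prod>p\<in>UNIV. (x $ p) ^ b p)" for x :: "'k ^ 'n"
  have "f \<in> polynomial_functions"
    unfolding polynomial_functions_def
    by (intro CollectI exI[of _ "{a, b}"] exI[of _ "\<lambda>d. if d = a then 1 else - 1"]) (use False in \<open>auto simp: f_def\<close>)
  then have "zariski_closed {x. f x = 0}"
    unfolding zariski_closed_def by (intro exI[of _ "{f}"]) auto
  then have "zariski_closed hull S \<subseteq> {x. f x = 0}"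
    using S by (intro hull_minimal) (auto simp: f_def)
  then show ?thesis
    using assms(2) by (auto simp: f_def)
qed simp

lemma separation_property_coordinates:
  fixes X :: "('k::field ^ 'n::finite) set"
  assumes "separation_property (*s) X" "i \<noteq> j"
  obtains x where "x \<in> X" "x $ i = 0" "x $ j \<noteq> 0"
proof -
  have "a = 0 \<and> b = 0" if "\<forall>x :: 'k ^ 'n. a * x $ i + b * x $ j = 0" for a b
    using that[THEN spec, of "axis i 1"] that[THEN spec, of "axis j 1"] assms(2) by (simp add: axis_def)
  then show thesis
    using assms(1) linear_nth[of i] linear_nth[of j] that unfolding separation_property_def by blast
qed

text \<open>Negative exponents are moved to the other side, so that the equation becomes polynomial
  and passes to the closure, where coordinates may vanish.\<close>

lemma power_int_eq_1_iff_powers_eq: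
  assumes "\<And>p. p \<in> P \<Longrightarrow> (y p :: 'k::field) \<noteq> 0"
  shows "(\<Prod>p\<in>P. y p powi k p) = 1 \<longleftrightarrow> (\<Prod>p\<in>P. y p ^ nat (k p)) = (\<Prod>p\<in>P. y p ^ nat (- k p))"
proof -
  have "(\<Prod>p\<in>P. y p powi k p) = (\<Prod>p\<in>P. y p ^ nat (k p) / y p ^ nat (- k p))"
    by (intro prod.cong) (auto simp: power_int_def field_simps)
  also have "\<dots> = (\<Prod>p\<in>P. y p ^ nat (k p)) / (\<Prod>p\<in>P. y p ^ nat (- k p))"
    by (rule prod_dividef)
  finally show ?thesis
    using assms by (cases "finite P") (simp_all add: divide_eq_1_iff)
qed

section \<open>Orbit closures with the separation property\<close>

context coordinatized_torus
begin

context
  fixes s :: "rat \<Rightarrow> 'w::ab_group_add \<Rightarrow> 'w" and \<iota> :: "('t \<Rightarrow> 'k) \<Rightarrow> 'w"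
    and c :: "'n::finite \<Rightarrow> 't \<Rightarrow> 'k"
  assumes rat: "rationalization \<Lambda> s \<iota>" and c: "\<And>i. c i \<in> carrier \<Lambda>"
begin

interpretation W: vector_space s
  using rat by (simp add: rationalization_def)

definition orbit :: "('k ^ 'n) set" where
  "orbit = (\<lambda>t. diagonal_action c t 1) ` carrier T"

lemma orbit_eq: "orbit = (\<lambda>t. \<chi> p. c p t) ` carrier T"
  by (simp add: orbit_def diagonal_action_def)

text \<open>A cocharacter proportional to the functional exposing \<open>i\<close> traces a curve in
  the orbit whose exponents are 0 at \<open>i\<close> and positive elsewhere. The orbit is closed
  under coordinatewise products because characters are multiplicative.\<close>

lemma separation_property_if_exposed:
  assumes "\<And>i. \<exists>l. Vector_Spaces.linear s (*) l \<and> l (\<iota> (c i)) = 0 \<and> (\<forall>p. p \<noteq> i \<longrightarrow> 0 < l (\<iota> (c p)))"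
  shows "separation_property (*s) (zariski_closed hull orbit)"
proof -
  have "\<exists>m \<gamma>. m i = 0 \<and> (\<forall>p. p \<noteq> i \<longrightarrow> 0 < m p) \<and>
      (\<forall>z. z \<noteq> 0 \<longrightarrow> \<gamma> z \<in> carrier T \<and> (\<forall>p. c p (\<gamma> z) = z ^ m p))" for i
  proof -
    obtain l where l: "Vector_Spaces.linear s (*) l" "l (\<iota> (c i)) = 0" "\<And>p. p \<noteq> i \<Longrightarrow> 0 < l (\<iota> (c p))"
      using assms by blast
    obtain N :: nat and \<gamma> where N: "N > 0" and \<gamma>: "\<And>z. z \<noteq> 0 \<Longrightarrow> \<gamma> z \<in> carrier T"
      and e: "\<And>\<theta>. \<theta> \<in> carrier \<Lambda> \<Longrightarrow>
        \<exists>e. of_nat N * l (\<iota> \<theta>) = of_int e \<and> (\<forall>z. z \<noteq> 0 \<longrightarrow> \<theta> (\<gamma> z) = z powi e)"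
      using cocharacter_of_functional[OF rat l(1)] by blast
    obtain e where e: "\<And>p. of_nat N * l (\<iota> (c p)) = of_int (e p)"
      "\<And>p z. z \<noteq> 0 \<Longrightarrow> c p (\<gamma> z) = z powi e p"
      using e[OF c] by metis
    have "e i = 0"
      using e(1)[of i] l(2) by simp
    moreover have "0 < e p" if "p \<noteq> i" for p
      using e(1)[of p] l(3)[OF that] N by (metis mult_pos_pos of_int_0_less_iff of_nat_0_less_iff)
    ultimately have pos: "\<And>p. 0 \<le> e p" "nat (e i) = 0" "\<And>p. p \<noteq> i \<Longrightarrow> 0 < nat (e p)"
      by (metis less_imp_le order.refl, simp, simp)
    have "c p (\<gamma> z) = z ^ nat (e p)" if "z \<noteq> 0" for p z
      using e(2)[OF that] pos(1) by (simp add: power_int_def)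
    then show ?thesis
      using pos(2,3) \<gamma> by (intro exI[of _ "\<lambda>p. nat (e p)"] exI[of _ \<gamma>]) auto
  qed
  then obtain m \<gamma> where m: "\<And>i. m i i = 0" "\<And>i p. p \<noteq> i \<Longrightarrow> 0 < m i p"
    and \<gamma>: "\<And>i z. z \<noteq> 0 \<Longrightarrow> \<gamma> i z \<in> carrier T" "\<And>i p z. z \<noteq> 0 \<Longrightarrow> c p (\<gamma> i z) = z ^ m i p"
    by metis
  show ?thesis
  proof (rule separation_property_if_exposing_curves[of orbit m])
    fix x y assume "x \<in> orbit" "y \<in> orbit"
    then obtain t u where tu: "t \<in> carrier T" "x = (\<chi> p. c p t)" "u \<in> carrier T" "y = (\<chi> p. c p u)"
      by (auto simp: orbit_eq)
    have "c p (t \<otimes>\<^bsub>T\<^esub> u) = c p t * c p u" for p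
      using c[of p] tu by (auto simp: character_group_def hom_def)
    then show "(\<chi> p. x $ p * y $ p) \<in> orbit"
      unfolding orbit_eq using tu by (intro image_eqI[of _ _ "t \<otimes>\<^bsub>T\<^esub> u"]) simp_all
  next
    fix i and z :: 'k assume "z \<noteq> 0"
    then show "(\<chi> p. z ^ m i p) \<in> orbit"
      unfolding orbit_eq using \<gamma> by (intro image_eqI[of _ _ "\<gamma> i z"]) simp_all
  qed (use m in auto)
qed

lemma binomial_relation_on_orbit_closure:
  assumes "(\<Sum>p\<in>UNIV. s (of_int (k p)) (\<iota> (c p))) = 0" and "x \<in> zariski_closed hull orbit"
  shows "(\<Prod>p\<in>UNIV. (x $ p) ^ nat (k p)) = (\<Prod>p\<in>UNIV. (x $ p) ^ nat (- k p))"
proof (rule binomial_on_zariski_hull[OF _ assms(2)])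
  fix y assume "y \<in> orbit"
  then obtain t where t: "t \<in> carrier T" "y = (\<chi> p. c p t)"
    by (auto simp: orbit_eq)
  have "c p t \<noteq> 0" for p
    using c[of p] t(1) by (auto simp: character_group_def hom_def)
  then show "(\<Prod>p\<in>UNIV. (y $ p) ^ nat (k p)) = (\<Prod>p\<in>UNIV. (y $ p) ^ nat (- k p))"
    using monomial_relation[OF rat c assms(1) t(1)] by (simp add: t(2) power_int_eq_1_iff_powers_eq)
qed

text \<open>Only the coefficient at \<open>i\<close> may be negative, so one side of the binomial
  equation is a power of the i-th coordinate alone. If \<open>q j > 0\<close>, the other side
  contains the j-th coordinate, contradicting a point where the j-th vanishes and the i-th does
  not.\<close>

lemma relation_trivial_if_separation_property:
  assumes sp: "separation_property (*s) (zariski_closed hull orbit)"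
    and rel: "(\<Sum>p\<in>UNIV. s (q p) (\<iota> (c p))) = 0" and q: "\<And>p. p \<noteq> i \<Longrightarrow> 0 \<le> q p" and "j \<noteq> i"
  shows "q j = 0"
proof (rule ccontr)
  assume "q j \<noteq> 0"
  obtain N k where N: "N > 0" "\<And>p. of_nat N * q p = of_int (k p)"
    using common_denominator[of UNIV q] by (metis UNIV_I finite)
  have "(\<Sum>p\<in>UNIV. s (of_int (k p)) (\<iota> (c p))) = s (of_nat N) (\<Sum>p\<in>UNIV. s (q p) (\<iota> (c p)))"
    by (simp add: W.scale_sum_right N(2))
  then have binomial: "(\<Prod>p\<in>UNIV. (x $ p) ^ nat (k p)) = (\<Prod>p\<in>UNIV. (x $ p) ^ nat (- k p))"
    if "x \<in> zariski_closed hull orbit" for x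
    using that rel by (intro binomial_relation_on_orbit_closure) simp_all
  have k: "0 \<le> k p" if "p \<noteq> i" for p
    using N(2)[of p] q[OF that] by (metis mult_nonneg_nonneg of_int_0_le_iff of_nat_0_le_iff)
  have "k j \<noteq> 0"
    using N(1) N(2)[of j] \<open>q j \<noteq> 0\<close> by auto
  then have "0 < nat (k j)"
    using k[OF \<open>j \<noteq> i\<close>] by simp
  obtain x where x: "x \<in> zariski_closed hull orbit" "x $ j = 0" "x $ i \<noteq> 0"
    using separation_property_coordinates[OF sp \<open>j \<noteq> i\<close>] by blast
  have "(\<Prod>p\<in>UNIV. (x $ p) ^ nat (k p)) = 0"
    using x(2) \<open>0 < nat (k j)\<close> by (intro prod_zero) (auto intro!: bexI[of _ j])
  moreover have "(x $ p) ^ nat (- k p) \<noteq> 0" for p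
    using k[of p] x(3) by (cases "p = i") auto
  then have "(\<Prod>p\<in>UNIV. (x $ p) ^ nat (- k p)) \<noteq> 0"
    unfolding prod_zero_iff[OF finite] by blast
  ultimately show False
    unfolding binomial[OF x(1)] by contradiction
qed

text \<open>A nonnegative combination of the other weights on the line of
  \<open>\<iota> (c i)\<close> is a relation whose only coefficient of free sign is at
  \<open>i\<close>, hence trivial; the alternative modulo that line gives the functional.\<close>

lemma exposed_if_separation_property:
  assumes sp: "separation_property (*s) (zariski_closed hull orbit)" and "j \<noteq> i"
  shows "\<iota> (c i) \<noteq> 0"
    and "\<exists>l. Vector_Spaces.linear s (*) l \<and> l (\<iota> (c i)) = 0 \<and> (\<forall>p. p \<noteq> i \<longrightarrow> 0 < l (\<iota> (c p)))"
proof -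
  show nz: "\<iota> (c i) \<noteq> 0"
  proof
    assume "\<iota> (c i) = 0"
    then have "(\<Sum>p\<in>UNIV. s (of_bool (p = i)) (\<iota> (c p))) = 0"
      by (intro sum.neutral) auto
    \<comment> \<open>The roles of the two indices are exchanged: here the coefficient at
      \<open>j\<close> is the one of free sign.\<close>
    then show False
      using relation_trivial_if_separation_property[OF sp, of "\<lambda>p. of_bool (p = i)" j i] \<open>j \<noteq> i\<close> by auto
  qed
  have "\<forall>p\<in>UNIV - {i}. q p = 0"
    if q: "\<forall>p\<in>UNIV - {i}. 0 \<le> q p" "(\<Sum>p\<in>UNIV - {i}. s (q p) (\<iota> (c p))) = s a (\<iota> (c i))" for q a
  proof -
    have "(\<Sum>p\<in>UNIV. s ((q(i := - a)) p) (\<iota> (c p))) =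
        s (- a) (\<iota> (c i)) + (\<Sum>p\<in>UNIV - {i}. s (q p) (\<iota> (c p)))"
      by (subst sum.remove[of _ i]) auto
    also have "\<dots> = 0"
      by (simp add: q(2))
    finally show ?thesis
      using relation_trivial_if_separation_property[OF sp, of "q(i := - a)" i] q(1) by fastforce
  qed
  then show "\<exists>l. Vector_Spaces.linear s (*) l \<and> l (\<iota> (c i)) = 0 \<and> (\<forall>p. p \<noteq> i \<longrightarrow> 0 < l (\<iota> (c p)))"
    using functional_positive_except_line[OF W.vector_space_axioms, of "UNIV - {i}" "\<iota> (c i)" "\<lambda>p. \<iota> (c p)"] nz
    by auto
qed

lemma convexity_conditions_if_exposed:
  assumes exposed: "\<And>i. \<exists>l. Vector_Spaces.linear s (*) l \<and> l (\<iota> (c i)) = 0 \<and> (\<forall>p. p \<noteq> i \<longrightarrow> 0 < l (\<iota> (c p)))"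
    and nonzero: "\<And>i. \<iota> (c i) \<noteq> 0"
  shows "strictly_convex s (cone_generated s (\<lambda>i. \<iota> (c i)))"
    and "is_edge s (cone_generated s (\<lambda>i. \<iota> (c i))) (ray s (\<iota> (c i)))"
    and "i \<noteq> j \<Longrightarrow> ray s (\<iota> (c i)) \<noteq> ray s (\<iota> (c j))"
proof -
  have vs: "vector_space s"
    by (rule W.vector_space_axioms)
  obtain l where l: "\<And>i. Vector_Spaces.linear s (*) (l i)" "\<And>i. l i (\<iota> (c i)) = 0"
    "\<And>i p. p \<noteq> i \<Longrightarrow> 0 < l i (\<iota> (c p))"
    using exposed by metis
  show "is_edge s (cone_generated s (\<lambda>i. \<iota> (c i))) (ray s (\<iota> (c i)))" for i
    by (rule is_edge_ray_if_exposed[where v = "\<lambda>i. \<iota> (c i)", OF vs nonzero l])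
  show "ray s (\<iota> (c i)) \<noteq> ray s (\<iota> (c j))" if "i \<noteq> j" for i j
  proof
    assume "ray s (\<iota> (c i)) = ray s (\<iota> (c j))"
    then have "\<iota> (c i) \<in> ray s (\<iota> (c j))"
      using generator_in_ray[OF vs] by blast
    then obtain q where "\<iota> (c i) = s q (\<iota> (c j))"
      by (auto simp: ray_def)
    then have "l j (\<iota> (c i)) = q * l j (\<iota> (c j))"
      using l(1)[of j] by (simp add: Vector_Spaces.linear_iff)
    then show False
      using l(3)[OF that] l(2)[of j] by simp
  qed
  have "\<exists>L. Vector_Spaces.linear s (*) L \<and> (\<forall>p. 0 < L (\<iota> (c p)))"
  \<comment> \<open>Each weight is annihilated by at most one of two exposing functionals with
    different indices, so their sum is positive on all weights.\<close>
  proof (cases "\<exists>i j :: 'n. i \<noteq> j")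
    case True
    then obtain i j :: 'n where ij: "i \<noteq> j"
      by blast
    have nonneg: "0 \<le> l i (\<iota> (c p))" for i p
      using l(2,3) by (metis less_imp_le order.refl)
    have "0 < l i (\<iota> (c p)) + l j (\<iota> (c p))" for p
      using ij l(3)[of p i] l(3)[of p j] nonneg[of i p] nonneg[of j p]
      by (cases "p = i") (auto intro: add_nonneg_pos add_pos_nonneg)
    moreover have "Vector_Spaces.linear s (*) (\<lambda>x. l i x + l j x)"
      using l(1)[of i] l(1)[of j] by (simp add: Vector_Spaces.linear_iff algebra_simps)
    ultimately show ?thesis
      by blast
  next
    case False
    \<comment> \<open>With a single index, \<open>undefined\<close> denotes that index.\<close>
    obtain L where "Vector_Spaces.linear s (*) L" "L (\<iota> (c undefined)) = 1"
      using linear_functional_nonzero_ex[OF vs nonzero] by blast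
    then show ?thesis
      using False by (metis zero_less_one)
  qed
  then obtain L where "Vector_Spaces.linear s (*) L" "\<And>p. 0 < L (\<iota> (c p))"
    by blast
  then show "strictly_convex s (cone_generated s (\<lambda>i. \<iota> (c i)))"
    by (intro strictly_convex_if_positive_functional[OF vs])
qed

text \<open>If \<open>CARD('n) = 1\<close>, both sides always hold: the zero functional exposes the
  only weight, and a zero weight falls under the degenerate clause. Otherwise both sides say that
  all weights are nonzero and exposed.\<close>

lemma separation_property_iff:
  "separation_property (*s) (zariski_closed hull orbit) \<longleftrightarrow>
     strictly_convex s (cone_generated s (\<lambda>i. \<iota> (c i))) \<and>
     (\<forall>i. is_edge s (cone_generated s (\<lambda>i. \<iota> (c i))) (ray s (\<iota> (c i))) \<or> (CARD('n) = 1 \<and> c i = \<one>\<^bsub>\<Lambda>\<^esub>)) \<and>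
     (\<forall>i j. i \<noteq> j \<longrightarrow> ray s (\<iota> (c i)) \<noteq> ray s (\<iota> (c j)))"
  (is "?sp \<longleftrightarrow> ?convex \<and> ?edges \<and> ?distinct")
proof (cases "CARD('n) = 1")
  case True
  then have single: "p = i" for p i :: 'n
    by (metis card_1_singletonE UNIV_I singletonD)
  have linear_zero: "Vector_Spaces.linear s (*) (\<lambda>_. 0)"
    using W.vector_space_axioms vector_space_over_itself.vector_space_axioms
    by (simp add: Vector_Spaces.linear_iff)
  have exposed: "\<exists>l. Vector_Spaces.linear s (*) l \<and> l (\<iota> (c i)) = 0 \<and> (\<forall>p. p \<noteq> i \<longrightarrow> 0 < l (\<iota> (c p)))" for i
    using single linear_zero by (intro exI[of _ "\<lambda>_. 0"]) auto
  have ?sp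
    by (rule separation_property_if_exposed[OF exposed])
  moreover have "?convex \<and> ?edges \<and> ?distinct"
  proof (cases "\<exists>i. \<iota> (c i) = 0")
    case True
    then have zero: "\<iota> (c i) = 0" for i
      using single by metis
    then have ?convex
      by (intro strictly_convex_if_positive_functional[OF W.vector_space_axioms linear_zero]) auto
    moreover have ?edges
      using \<open>CARD('n) = 1\<close> \<iota>_eq_0_imp_one[OF rat c zero] by blast
    ultimately show ?thesis
      using single by blast
  next
    case False
    then have nonzero: "\<iota> (c i) \<noteq> 0" for i
      by blast
    show ?thesis
      using convexity_conditions_if_exposed[OF exposed nonzero] by blast
  qed
  ultimately show ?thesis
    by blast
next
  case False
  have other: "\<exists>j. j \<noteq> i" for i :: 'n
  proof (rule ccontr)
    assume "\<nexists>j. j \<noteq> i"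
    then have "(UNIV :: 'n set) = {i}"
      by auto
    then have "CARD('n) = card {i}"
      by (rule arg_cong)
    then show False
      using False by simp
  qed
  show ?thesis
  proof
    assume sp: ?sp
    have nonzero: "\<iota> (c i) \<noteq> 0" for i
      using other[of i] by (elim exE) (rule exposed_if_separation_property(1)[OF sp])
    have exposed: "\<exists>l. Vector_Spaces.linear s (*) l \<and> l (\<iota> (c i)) = 0 \<and> (\<forall>p. p \<noteq> i \<longrightarrow> 0 < l (\<iota> (c p)))" for i
      using other[of i] by (elim exE) (rule exposed_if_separation_property(2)[OF sp])
    show "?convex \<and> ?edges \<and> ?distinct"
      using convexity_conditions_if_exposed[OF exposed nonzero] by blast
  next
    assume conditions: "?convex \<and> ?edges \<and> ?distinct"
    then have edge: "is_edge s (cone_generated s (\<lambda>i. \<iota> (c i))) (ray s (\<iota> (c i)))" for i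
      using False by blast
    have nonzero: "\<iota> (c i) \<noteq> 0" for i
      using is_edge_ray_imp_nonzero[OF W.vector_space_axioms edge] .
    show ?sp
    proof (rule separation_property_if_exposed)
      fix i
      have "ray s (\<iota> (c p)) \<noteq> ray s (\<iota> (c i))" if "p \<noteq> i" for p
        using conditions that by blast
      then show "\<exists>l. Vector_Spaces.linear s (*) l \<and> l (\<iota> (c i)) = 0 \<and> (\<forall>p. p \<noteq> i \<longrightarrow> 0 < l (\<iota> (c p)))"
        by (rule exposed_if_is_edge_ray[of s "\<lambda>i. \<iota> (c i)" i, OF W.vector_space_axioms edge nonzero])
    qed
  qed
qed

end

end

theorem theorem3:
  fixes T :: "('t, 'm) monoid_scheme"
    and R :: "('t \<Rightarrow> 'k::alg_closed_field) set"
    and \<Lambda> :: "('t \<Rightarrow> 'k) monoid"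
    and s :: "rat \<Rightarrow> 'w::ab_group_add \<Rightarrow> 'w"
    and \<iota> :: "('t \<Rightarrow> 'k) \<Rightarrow> 'w"
    and c :: "'n::finite \<Rightarrow> 't \<Rightarrow> 'k"
    and K :: "'w set"
    and X :: "('k^'n) set"
  assumes "algebraic_torus T R"
    and "\<Lambda> = character_group T R"
    and "rationalization \<Lambda> s \<iota>"
    and "\<forall>i. c i \<in> carrier \<Lambda>"
    and "K = cone_generated s (\<lambda>i. \<iota> (c i))"
    and "X = zariski_closed hull ((\<lambda>t. diagonal_action c t 1) ` carrier T)"
  shows "separation_property (*s) X \<longleftrightarrow>
     strictly_convex s K \<and>
     (\<forall>i. is_edge s K (ray s (\<iota> (c i))) \<or> (CARD('n) = 1 \<and> c i = \<one>\<^bsub>\<Lambda>\<^esub>)) \<and>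
     (\<forall>i j. i \<noteq> j \<longrightarrow> ray s (\<iota> (c i)) \<noteq> ray s (\<iota> (c j)))"
proof -
  obtain r \<phi> where "coordinatized_torus T R r \<phi>"
    using assms(1) unfolding algebraic_torus_def coordinatized_torus_def by blast
  then interpret coordinatized_torus T R r \<phi> .
  show ?thesis
    using separation_property_iff[of s \<iota> c] assms orbit_def[of s \<iota> c] by simp
qed

end
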